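(* Let $(M_1^{2m},g_1)$, $m\geq 1$, be a Riemannian spin manifold admitting a Killing spinor $\psi_1$ with $D_1\psi_1=\lambda_1\psi_1$, $\lambda_1\neq 0\in\mathbb{R}$. Let $(M_2^{2m},g_2)$ be a Riemannian spin manifold admitting a Killing spinor $\psi_2$ with $D_2\psi_2=\lambda_2\psi_2$, $\lambda_2\in\mathbb{R}$ (here $\lambda_2$ is allowed to be zero). Then the Riemannian product manifold $(M^n,g)=(M_1^{2m}\times M_2^{2m},\,g_1+g_2)$, $n=4m$, admits a non-trivial eigenspinor $\psi^{\ast}$ of its Dirac operator $D$ such that $$\nabla_X\psi^{\ast}=-\frac{\lambda^{\ast}}{n}\,X\cdot\psi^{\ast}-\frac{1}{n}\,\phi(X)\cdot\widetilde{D}\psi^{\ast}$$ holds for some real number $\lambda^{\ast}\neq 0$ and for all vector fields $X$.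
   Context: Manifolds are smooth, oriented and without boundary. "$\cdot$" is Clifford multiplication with $X\cdot Y+Y\cdot X=-2g(X,Y)$, and $\nabla$ denotes the spin derivative induced by the Levi-Civita connection. $D_i$ is the Dirac operator of $(M_i,g_i)$. A Killing spinor $\psi_i$ on $(M_i,g_i)$ with $D_i\psi_i=\lambda_i\psi_i$ is a non-trivial spinor field satisfying $\nabla^i_X\psi_i=-\frac{\lambda_i}{\dim M_i}X\cdot\psi_i$ for all vector fields $X$ on $M_i$ (if $\lambda_i=0$ is allowed, this means $\psi_i$ is parallel). The product carries the naturally induced product spin structure. Its product structure $\phi$ is the parallel $(1,1)$-tensor field equal to the identity on vectors tangent to $M_1$ and to minus the identity on vectors tangent to $M_2$. With a local orthonormal frame $(E_1,\dots,E_n)$ of the product, $D\psi=\sum_{i=1}^n E_i\cdot\nabla_{E_i}\psi$ and $\widetilde{D}\psi=\sum_{i=1}^n E_i\cdot\nabla_{\phi(E_i)}\psi$. *)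

theory Defs
  imports "HOL-Analysis.Analysis"
begin

section \<open>Smooth maps on open subsets of Euclidean spaces\<close>

text \<open>Only used for open \<open>S\<close> in a finite-dimensional domain, where differentiability together with
  the regularity of all directional derivatives is the usual class \<open>C^k\<close>.\<close>

primrec Ck_on :: "nat \<Rightarrow> ('a::euclidean_space \<Rightarrow> 'b::real_normed_vector) \<Rightarrow> 'a set \<Rightarrow> bool" where
  "Ck_on 0 f S \<longleftrightarrow> continuous_on S f"
| "Ck_on (Suc k) f S \<longleftrightarrow> (\<forall>x\<in>S. f differentiable (at x)) \<and>
     (\<forall>v. Ck_on k (\<lambda>x. frechet_derivative f (at x) v) S)"

definition smooth_on :: "('a::euclidean_space \<Rightarrow> 'b::real_normed_vector) \<Rightarrow> 'a set \<Rightarrow> bool" where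
  "smooth_on f S \<longleftrightarrow> (\<forall>k. Ck_on k f S)"


section \<open>Manifolds and tensor fields in charts\<close>

text \<open>The points of a manifold are the elements of a type \<open>'a\<close>, the charts
  \<open>chart M i : chart_dom M i \<rightarrow> 'e\<close> are indexed by \<open>i \<in> idx M\<close>. All geometric objects are given by
  their components in the charts: a vector field \<open>X\<close> has the components \<open>X i p\<close> in the chart \<open>i\<close>
  at the point \<open>p\<close>. Components at points outside of \<open>chart_dom M i\<close> are junk.\<close>

record ('a, 'i, 'e) atlas =
  idx :: "'i set"
  chart_dom :: "'i \<Rightarrow> 'a set"
  chart :: "'i \<Rightarrow> 'a \<Rightarrow> 'e"

definition in_chart :: "('a, 'i, 'e, 'z) atlas_scheme \<Rightarrow> 'i \<Rightarrow> ('a \<Rightarrow> 'b) \<Rightarrow> 'e \<Rightarrow> 'b" where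
  "in_chart M i f = f \<circ> inv_into (chart_dom M i) (chart M i)"

definition dir_deriv ::
    "('a, 'i, 'e::euclidean_space, 'z) atlas_scheme \<Rightarrow> 'i \<Rightarrow> ('a \<Rightarrow> 'b::real_normed_vector) \<Rightarrow> 'a \<Rightarrow> 'e \<Rightarrow> 'b" where
  "dir_deriv M i f p v = frechet_derivative (in_chart M i f) (at (chart M i p)) v"

definition smooth_manifold ::
    "('a::{t2_space, second_countable_topology}, 'i, 'e::euclidean_space, 'z) atlas_scheme \<Rightarrow> bool" where
  "smooth_manifold M \<longleftrightarrow>
     (\<Union>i\<in>idx M. chart_dom M i) = UNIV \<and>
     (\<forall>i\<in>idx M. open (chart_dom M i) \<and> open (chart M i ` chart_dom M i) \<and>
        homeomorphism (chart_dom M i) (chart M i ` chart_dom M i) (chart M i) (inv_into (chart_dom M i) (chart M i))) \<and>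
     (\<forall>i\<in>idx M. \<forall>j\<in>idx M.
        smooth_on (in_chart M i (chart M j)) (chart M i ` (chart_dom M i \<inter> chart_dom M j)))"

text \<open>\<open>coord_change M i j p\<close> converts the components of a tangent vector at \<open>p\<close> from the chart \<open>i\<close>
  to the chart \<open>j\<close>.\<close>

definition coord_change ::
    "('a, 'i, 'e::euclidean_space, 'z) atlas_scheme \<Rightarrow> 'i \<Rightarrow> 'i \<Rightarrow> 'a \<Rightarrow> 'e \<Rightarrow> 'e" where
  "coord_change M i j p = dir_deriv M i (chart M j) p"

definition vector_field ::
    "('a, 'i, 'e::euclidean_space, 'z) atlas_scheme \<Rightarrow> ('i \<Rightarrow> 'a \<Rightarrow> 'e) \<Rightarrow> bool" where
  "vector_field M X \<longleftrightarrow>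
     (\<forall>i\<in>idx M. smooth_on (in_chart M i (X i)) (chart M i ` chart_dom M i)) \<and>
     (\<forall>i\<in>idx M. \<forall>j\<in>idx M. \<forall>p\<in>chart_dom M i \<inter> chart_dom M j. X j p = coord_change M i j p (X i p))"


section \<open>Riemannian metrics and the Levi-Civita connection\<close>

record ('a, 'i, 'e) riem_atlas = "('a, 'i, 'e) atlas" +
  riem_metric :: "'i \<Rightarrow> 'a \<Rightarrow> 'e \<Rightarrow> 'e \<Rightarrow> real"

definition riemannian_manifold ::
    "('a::{t2_space, second_countable_topology}, 'i, 'e::euclidean_space, 'z) riem_atlas_scheme \<Rightarrow> bool" where
  "riemannian_manifold M \<longleftrightarrow>
     smooth_manifold M \<and>
     (\<forall>i\<in>idx M. \<forall>p\<in>chart_dom M i. bilinear (riem_metric M i p) \<and>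
        (\<forall>v w. riem_metric M i p v w = riem_metric M i p w v) \<and>
        (\<forall>v. v \<noteq> 0 \<longrightarrow> riem_metric M i p v v > 0)) \<and>
     (\<forall>i\<in>idx M. \<forall>v w. smooth_on (in_chart M i (\<lambda>p. riem_metric M i p v w)) (chart M i ` chart_dom M i)) \<and>
     (\<forall>i\<in>idx M. \<forall>j\<in>idx M. \<forall>p\<in>chart_dom M i \<inter> chart_dom M j. \<forall>v w.
        riem_metric M j p (coord_change M i j p v) (coord_change M i j p w) = riem_metric M i p v w)"

text \<open>In a chart, a connection has the form \<open>\<nabla>\<^sub>v Y = dY(v) + \<Gamma>(v, Y)\<close>; it is torsion-free iff
  \<open>\<Gamma>\<close> is symmetric, and metric iff \<open>dg(v, w)(u) = g(\<Gamma>(u, v), w) + g(v, \<Gamma>(u, w))\<close>.\<close>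

definition levi_civita_at ::
    "('a, 'i, 'e::euclidean_space, 'z) riem_atlas_scheme \<Rightarrow> 'i \<Rightarrow> 'a \<Rightarrow> ('e \<Rightarrow> 'e \<Rightarrow> 'e) \<Rightarrow> bool" where
  "levi_civita_at M i p \<Gamma> \<longleftrightarrow>
     bilinear \<Gamma> \<and> (\<forall>v w. \<Gamma> v w = \<Gamma> w v) \<and>
     (\<forall>u v w. dir_deriv M i (\<lambda>q. riem_metric M i q v w) p u =
        riem_metric M i p (\<Gamma> u v) w + riem_metric M i p v (\<Gamma> u w))"

definition christoffel ::
    "('a, 'i, 'e::euclidean_space, 'z) riem_atlas_scheme \<Rightarrow> 'i \<Rightarrow> 'a \<Rightarrow> 'e \<Rightarrow> 'e \<Rightarrow> 'e" where
  "christoffel M i p = (THE \<Gamma>. levi_civita_at M i p \<Gamma>)"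

definition cov_deriv ::
    "('a, 'i, 'e::euclidean_space, 'z) riem_atlas_scheme \<Rightarrow> ('i \<Rightarrow> 'a \<Rightarrow> 'e) \<Rightarrow> ('i \<Rightarrow> 'a \<Rightarrow> 'e) \<Rightarrow> 'i \<Rightarrow> 'a \<Rightarrow> 'e" where
  "cov_deriv M X Y i p = dir_deriv M i (Y i) p (X i p) + christoffel M i p (X i p) (Y i p)"


section \<open>Spinor modules and the spin group\<close>

text \<open>An irreducible complex module of the Clifford algebra of Euclidean \<open>n\<close>-space has the
  dimension \<open>2 ^ (n div 2)\<close>, and conversely a module of this dimension is irreducible.\<close>

definition spinor_module :: "nat \<Rightarrow> (nat \<Rightarrow> complex^'s^'s) \<Rightarrow> bool" where
  "spinor_module n \<gamma> \<longleftrightarrow>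
     CARD('s) = 2 ^ (n div 2) \<and>
     (\<forall>k<n. \<forall>l<n. \<gamma> k ** \<gamma> l + \<gamma> l ** \<gamma> k = (if k = l then - mat 2 else 0))"

definition clifford_vec :: "nat \<Rightarrow> (nat \<Rightarrow> complex^'s^'s) \<Rightarrow> (nat \<Rightarrow> real) \<Rightarrow> complex^'s^'s" where
  "clifford_vec n \<gamma> u = (\<Sum>k<n. u k *\<^sub>R \<gamma> k)"

text \<open>\<open>Spin(n)\<close> consists of the products of an even number of unit vectors. It acts faithfully on
  the spinor module and is identified with its image in the endomorphisms.\<close>

inductive_set spin_group :: "nat \<Rightarrow> (nat \<Rightarrow> complex^'s^'s) \<Rightarrow> (complex^'s^'s) set"
  for n :: nat and \<gamma> :: "nat \<Rightarrow> complex^'s^'s" where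
  one: "mat 1 \<in> spin_group n \<gamma>"
| mult: "s \<in> spin_group n \<gamma> \<Longrightarrow> (\<Sum>k<n. (u k)\<^sup>2) = 1 \<Longrightarrow> (\<Sum>k<n. (v k)\<^sup>2) = 1 \<Longrightarrow>
     s ** (clifford_vec n \<gamma> u ** clifford_vec n \<gamma> v) \<in> spin_group n \<gamma>"


section \<open>Riemannian spin manifolds\<close>

text \<open>A spin structure is given by its cocycle: local oriented orthonormal frames
  \<open>frame M 0 i, \<dots>, frame M (n-1) i\<close> together with lifts \<open>lift M i j\<close> to \<open>Spin(n)\<close> of the
  \<open>SO(n)\<close>-valued frame changes, satisfying the cocycle condition. The cover and the atlas are
  refined so that the frames live on the chart domains; \<open>frame M k i p\<close> are the components in the
  chart \<open>i\<close>. The orientation is the one for which these frames are positively oriented, the frame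
  changes having determinant 1 since they lift to \<open>Spin(n)\<close>.\<close>

record ('a, 'i, 'e, 's::finite) spin_atlas = "('a, 'i, 'e) riem_atlas" +
  gam :: "nat \<Rightarrow> complex^'s^'s"
  frame :: "nat \<Rightarrow> 'i \<Rightarrow> 'a \<Rightarrow> 'e"
  lift :: "'i \<Rightarrow> 'i \<Rightarrow> 'a \<Rightarrow> complex^'s^'s"

definition riemannian_spin_manifold ::
    "('a::{t2_space, second_countable_topology}, 'i, 'e::euclidean_space, 's::finite, 'z) spin_atlas_scheme \<Rightarrow> bool" where
  "riemannian_spin_manifold M \<longleftrightarrow>
     riemannian_manifold M \<and>
     spinor_module DIM('e) (gam M) \<and>
     (\<forall>i\<in>idx M. \<forall>k<DIM('e). smooth_on (in_chart M i (frame M k i)) (chart M i ` chart_dom M i)) \<and>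
     (\<forall>i\<in>idx M. \<forall>p\<in>chart_dom M i. \<forall>k<DIM('e). \<forall>l<DIM('e).
        riem_metric M i p (frame M k i p) (frame M l i p) = (if k = l then 1 else 0)) \<and>
     (\<forall>i\<in>idx M. \<forall>j\<in>idx M. smooth_on (in_chart M i (lift M i j)) (chart M i ` (chart_dom M i \<inter> chart_dom M j))) \<and>
     (\<forall>i\<in>idx M. \<forall>j\<in>idx M. \<forall>p\<in>chart_dom M i \<inter> chart_dom M j.
        lift M i j p \<in> spin_group DIM('e) (gam M) \<and>
        (\<forall>l<DIM('e). lift M i j p ** gam M l =
           clifford_vec DIM('e) (gam M)
             (\<lambda>k. riem_metric M i p (frame M k i p) (coord_change M j i p (frame M l j p))) ** lift M i j p)) \<and>
     (\<forall>i\<in>idx M. \<forall>j\<in>idx M. \<forall>k\<in>idx M. \<forall>p\<in>chart_dom M i \<inter> chart_dom M j \<inter> chart_dom M k.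
        lift M i j p ** lift M j k p = lift M i k p)"

text \<open>A spinor field is a section of the associated bundle: \<open>\<psi> i\<close> is its representation with
  respect to the spin frame over \<open>chart_dom M i\<close>.\<close>

definition spinor_field ::
    "('a, 'i, 'e::euclidean_space, 's::finite, 'z) spin_atlas_scheme \<Rightarrow> ('i \<Rightarrow> 'a \<Rightarrow> complex^'s) \<Rightarrow> bool" where
  "spinor_field M \<psi> \<longleftrightarrow>
     (\<forall>i\<in>idx M. smooth_on (in_chart M i (\<psi> i)) (chart M i ` chart_dom M i)) \<and>
     (\<forall>i\<in>idx M. \<forall>j\<in>idx M. \<forall>p\<in>chart_dom M i \<inter> chart_dom M j. \<psi> i p = lift M i j p *v \<psi> j p)"

definition same_field ::
    "('a, 'i, 'e, 'z) atlas_scheme \<Rightarrow> ('i \<Rightarrow> 'a \<Rightarrow> 'b) \<Rightarrow> ('i \<Rightarrow> 'a \<Rightarrow> 'b) \<Rightarrow> bool" where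
  "same_field M \<psi> \<phi> \<longleftrightarrow> (\<forall>i\<in>idx M. \<forall>p\<in>chart_dom M i. \<psi> i p = \<phi> i p)"

definition clifford_mult ::
    "('a, 'i, 'e::euclidean_space, 's::finite, 'z) spin_atlas_scheme \<Rightarrow>
     ('i \<Rightarrow> 'a \<Rightarrow> 'e) \<Rightarrow> ('i \<Rightarrow> 'a \<Rightarrow> complex^'s) \<Rightarrow> 'i \<Rightarrow> 'a \<Rightarrow> complex^'s" where
  "clifford_mult M X \<psi> i p =
     clifford_vec DIM('e) (gam M) (\<lambda>k. riem_metric M i p (X i p) (frame M k i p)) *v \<psi> i p"

text \<open>The derivative induced by the Levi-Civita connection on the associated bundle, i.e.
  \<open>\<nabla>\<^sub>X \<psi> = X(\<psi>) + 1/2 \<Sum> g(\<nabla>\<^sub>X E\<^sub>k, E\<^sub>l) E\<^sub>k \<cdot> E\<^sub>l \<cdot> \<psi>\<close> with the sum over \<open>k < l\<close>.\<close>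

definition spin_deriv ::
    "('a, 'i, 'e::euclidean_space, 's::finite, 'z) spin_atlas_scheme \<Rightarrow>
     ('i \<Rightarrow> 'a \<Rightarrow> 'e) \<Rightarrow> ('i \<Rightarrow> 'a \<Rightarrow> complex^'s) \<Rightarrow> 'i \<Rightarrow> 'a \<Rightarrow> complex^'s" where
  "spin_deriv M X \<psi> i p =
     dir_deriv M i (\<psi> i) p (X i p) +
     (1 / 2) *\<^sub>R (\<Sum>l<DIM('e). \<Sum>k<l.
        riem_metric M i p (cov_deriv M X (frame M k) i p) (frame M l i p) *\<^sub>R
          (gam M k *v (gam M l *v \<psi> i p)))"

definition dirac ::
    "('a, 'i, 'e::euclidean_space, 's::finite, 'z) spin_atlas_scheme \<Rightarrow>
     ('i \<Rightarrow> 'a \<Rightarrow> complex^'s) \<Rightarrow> 'i \<Rightarrow> 'a \<Rightarrow> complex^'s" where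
  "dirac M \<psi> i p =
     (\<Sum>k<DIM('e). clifford_mult M (frame M k) (spin_deriv M (frame M k) \<psi>) i p)"

definition nontrivial_spinor_field ::
    "('a, 'i, 'e::euclidean_space, 's::finite, 'z) spin_atlas_scheme \<Rightarrow> ('i \<Rightarrow> 'a \<Rightarrow> complex^'s) \<Rightarrow> bool" where
  "nontrivial_spinor_field M \<psi> \<longleftrightarrow> spinor_field M \<psi> \<and> (\<exists>i\<in>idx M. \<exists>p\<in>chart_dom M i. \<psi> i p \<noteq> 0)"

definition dirac_eigenspinor ::
    "('a, 'i, 'e::euclidean_space, 's::finite, 'z) spin_atlas_scheme \<Rightarrow> real \<Rightarrow>
     ('i \<Rightarrow> 'a \<Rightarrow> complex^'s) \<Rightarrow> bool" where
  "dirac_eigenspinor M \<mu> \<psi> \<longleftrightarrow>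
     nontrivial_spinor_field M \<psi> \<and> same_field M (dirac M \<psi>) (\<lambda>i p. \<mu> *\<^sub>R \<psi> i p)"

definition killing_spinor ::
    "('a, 'i, 'e::euclidean_space, 's::finite, 'z) spin_atlas_scheme \<Rightarrow> real \<Rightarrow>
     ('i \<Rightarrow> 'a \<Rightarrow> complex^'s) \<Rightarrow> bool" where
  "killing_spinor M \<mu> \<psi> \<longleftrightarrow>
     nontrivial_spinor_field M \<psi> \<and>
     (\<forall>X. vector_field M X \<longrightarrow>
        same_field M (spin_deriv M X \<psi>)
          (\<lambda>i p. - (\<mu> / real DIM('e)) *\<^sub>R clifford_mult M X \<psi> i p))"


section \<open>Riemannian products\<close>

definition kron :: "complex^'s^'s \<Rightarrow> complex^'t^'t \<Rightarrow> complex^('s \<times> 't)^('s \<times> 't)" where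
  "kron A B = (\<chi> r c. A $ fst r $ fst c * B $ snd r $ snd c)"

text \<open>The complex volume element; for even \<open>n\<close> it squares to 1 and anticommutes with the vectors.\<close>

definition volume_element :: "nat \<Rightarrow> (nat \<Rightarrow> complex^'s^'s) \<Rightarrow> complex^'s^'s" where
  "volume_element n \<gamma> = mat (\<i> ^ (n div 2)) ** foldr (**) (map \<gamma> [0..<n]) (mat 1)"

text \<open>For even \<open>n\<^sub>1\<close>, the spinor module of the orthogonal sum is the tensor product of the spinor
  modules, where the vectors of the second summand act by \<open>\<omega>\<^sub>1 \<otimes> \<gamma>\<^sub>2\<close>. The canonical map
  \<open>Spin(n\<^sub>1) \<times> Spin(n\<^sub>2) \<rightarrow> Spin(n\<^sub>1 + n\<^sub>2)\<close> then is the tensor product of operators.\<close>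

definition gam_prod ::
    "nat \<Rightarrow> (nat \<Rightarrow> complex^'s^'s) \<Rightarrow> (nat \<Rightarrow> complex^'t^'t) \<Rightarrow> nat \<Rightarrow> complex^('s \<times> 't)^('s \<times> 't)" where
  "gam_prod n1 \<gamma>1 \<gamma>2 k =
     (if k < n1 then kron (\<gamma>1 k) (mat 1) else kron (volume_element n1 \<gamma>1) (\<gamma>2 (k - n1)))"

definition spin_product ::
    "('a, 'i, 'e::euclidean_space, 's::finite) spin_atlas \<Rightarrow> ('b, 'j, 'f::euclidean_space, 't::finite) spin_atlas \<Rightarrow>
     ('a \<times> 'b, 'i \<times> 'j, 'e \<times> 'f, 's \<times> 't) spin_atlas" where
  "spin_product M1 M2 =
    \<lparr> idx = idx M1 \<times> idx M2,
      chart_dom = (\<lambda>(i, j). chart_dom M1 i \<times> chart_dom M2 j),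
      chart = (\<lambda>(i, j) (p, q). (chart M1 i p, chart M2 j q)),
      riem_metric = (\<lambda>(i, j) (p, q) (v1, v2) (w1, w2). riem_metric M1 i p v1 w1 + riem_metric M2 j q v2 w2),
      gam = gam_prod DIM('e) (gam M1) (gam M2),
      frame = (\<lambda>k (i, j) (p, q).
        if k < DIM('e) then (frame M1 k i p, 0) else (0, frame M2 (k - DIM('e)) j q)),
      lift = (\<lambda>(i, j) (i', j') (p, q). kron (lift M1 i i' p) (lift M2 j j' q)) \<rparr>"

definition product_structure ::
    "('c \<Rightarrow> 'a \<times> 'b \<Rightarrow> 'e \<times> 'f) \<Rightarrow> 'c \<Rightarrow> 'a \<times> 'b \<Rightarrow> 'e::real_vector \<times> 'f::real_vector" where
  "product_structure X c x = (fst (X c x), - snd (X c x))"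

definition dirac_tilde ::
    "('a \<times> 'b, 'c, 'e::euclidean_space \<times> 'f::euclidean_space, 's::finite, 'z) spin_atlas_scheme \<Rightarrow>
     ('c \<Rightarrow> 'a \<times> 'b \<Rightarrow> complex^'s) \<Rightarrow> 'c \<Rightarrow> 'a \<times> 'b \<Rightarrow> complex^'s" where
  "dirac_tilde M \<psi> c x =
     (\<Sum>k<DIM('e \<times> 'f).
        clifford_mult M (frame M k) (spin_deriv M (product_structure (frame M k)) \<psi>) c x)"


section \<open>The Levi-Civita connection is well defined\<close>

lemma smooth_on_imp_differentiable:
  assumes "smooth_on f S" "x \<in> S" shows "f differentiable (at x)"
proof -
  have "Ck_on (Suc 0) f S" using assms(1) unfolding smooth_on_def by blast
  then show ?thesis using assms(2) by simp
qed

lemma frechet_cong: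
  assumes "open S" "x \<in> S" "\<And>y. y \<in> S \<Longrightarrow> f y = g y" "f differentiable (at x)"
  shows "g differentiable (at x)" "frechet_derivative g (at x) = frechet_derivative f (at x)"
proof -
  have "(f has_derivative frechet_derivative f (at x)) (at x)"
    using assms(4) frechet_derivative_works by blast
  then have *: "(g has_derivative frechet_derivative f (at x)) (at x)"
    by (rule has_derivative_transform_within_open[OF _ assms(1,2)]) (use assms(3) in auto)
  show "g differentiable (at x)" using * differentiable_def by blast
  show "frechet_derivative g (at x) = frechet_derivative f (at x)"
    using frechet_derivative_at[OF *] by simp
qed

lemma metric_deriv:
  assumes M: "riemannian_manifold M" and i: "i \<in> idx M" and p: "p \<in> chart_dom M i"
  defines "D \<equiv> \<lambda>v w. dir_deriv M i (\<lambda>q. riem_metric M i q v w) p"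
  shows "bilinear (\<lambda>v w. D v w u)" "D v w = D w v" "linear (D v w)"
proof -
  let ?S = "chart M i ` chart_dom M i" and ?x = "chart M i p"
  let ?F = "\<lambda>v w. in_chart M i (\<lambda>q. riem_metric M i q v w)"
  have sm: "smooth_manifold M" using M unfolding riemannian_manifold_def by blast
  have o: "open ?S" using sm i unfolding smooth_manifold_def by blast
  have x: "?x \<in> ?S" using p by blast
  have q: "inv_into (chart_dom M i) (chart M i) y \<in> chart_dom M i" if "y \<in> ?S" for y
    using that by (rule inv_into_into)
  have d: "(?F v w has_derivative D v w) (at ?x)" for v w
  proof -
    have "smooth_on (?F v w) ?S" using M i unfolding riemannian_manifold_def by blast
    from smooth_on_imp_differentiable[OF this x] show ?thesis
      unfolding D_def dir_deriv_def[abs_def] using frechet_derivative_works by auto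
  qed
  have bil: "bilinear (riem_metric M i p)" and sym: "riem_metric M i p v w = riem_metric M i p w v"
    if "p \<in> chart_dom M i" for p v w using M i that unfolding riemannian_manifold_def by blast+
  show "linear (D v w)" for v w using d has_derivative_linear by blast
  have un: "D v w = h" if "(g has_derivative h) (at ?x)" "\<And>y. y \<in> ?S \<Longrightarrow> g y = ?F v w y" for v w g h
    using has_derivative_transform_within_open[OF that(1) o x that(2)] d has_derivative_unique by blast
  show "D v w = D w v" for v w
    by (rule un[OF d]) (auto simp: in_chart_def intro: sym q)
  have add: "D (v + v') w = (\<lambda>u. D v w u + D v' w u)" for v v' w
    by (rule un[OF has_derivative_add[OF d d]])
      (use bil[OF q] in \<open>simp add: in_chart_def bilinear_ladd\<close>)
  have sc: "D (c *\<^sub>R v) w = (\<lambda>u. c *\<^sub>R D v w u)" for c v w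
    by (rule un[OF has_derivative_scaleR_right[OF d]])
      (use bil[OF q] in \<open>simp add: in_chart_def bilinear_lmul\<close>)
  have add': "D v (w + w') = (\<lambda>u. D v w u + D v w' u)" for v w' w
    by (rule un[OF has_derivative_add[OF d d]])
      (use bil[OF q] in \<open>simp add: in_chart_def bilinear_radd\<close>)
  have sc': "D v (c *\<^sub>R w) = (\<lambda>u. c *\<^sub>R D v w u)" for c v w
    by (rule un[OF has_derivative_scaleR_right[OF d]])
      (use bil[OF q] in \<open>simp add: in_chart_def bilinear_rmul\<close>)
  show "bilinear (\<lambda>v w. D v w u)" unfolding bilinear_def
    by (auto intro!: linearI simp: fun_eq_iff add sc add' sc')
qed
lemma musical:
  fixes g :: "'e::euclidean_space \<Rightarrow> 'e \<Rightarrow> real"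
  assumes "bilinear g" "\<And>v. v \<noteq> 0 \<Longrightarrow> g v v > 0" "linear L"
  shows "\<exists>!v. \<forall>w. g v w = L w"
proof -
  let ?T = "\<lambda>v. \<Sum>b\<in>Basis. g v b *\<^sub>R b"
  have lin: "linear ?T"
    by (rule linearI)
      (simp_all add: bilinear_ladd[OF assms(1)] bilinear_lmul[OF assms(1)] scaleR_add_left sum.distrib scaleR_right.sum)
  have gb: "linear (g v)" for v using assms(1) unfolding bilinear_def by blast
  have ext: "(\<forall>w. g v w = L' w) \<longleftrightarrow> (\<forall>b\<in>Basis. g v b = L' b)" if "linear L'" for v L'
    using linear_eq_stdbasis[OF gb that] by (metis)
  have "inj ?T"
  proof (rule linear_injective_0[OF lin, THEN iffD2], intro allI impI)
    fix v assume *: "?T v = 0"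
    have "g v b = 0" if "b \<in> Basis" for b
    proof -
      have "?T v \<bullet> b = g v b" using that by (simp add: inner_sum_left inner_Basis if_distrib cong: if_cong)
      then show ?thesis using * by simp
    qed
    then have "\<forall>w. g v w = 0" using ext[of "\<lambda>_. 0"] by (simp add: linear_zero)
    then show "v = 0" using assms(2)[of v] by force
  qed
  then have "surj ?T" using lin linear_injective_imp_surjective by blast
  from surjD[OF this, of "\<Sum>b\<in>Basis. L b *\<^sub>R b"] obtain v
    where v: "?T v = (\<Sum>b\<in>Basis. L b *\<^sub>R b)" by (elim exE, simp only:)
  have "g v b = L b" if "b \<in> Basis" for b
  proof -
    have "?T v \<bullet> b = g v b" "(\<Sum>b\<in>Basis. L b *\<^sub>R b) \<bullet> b = L b"
      using that by (simp_all add: inner_sum_left inner_Basis if_distrib cong: if_cong)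
    then show ?thesis using v by simp
  qed
  then have 1: "\<forall>w. g v w = L w" using ext[OF assms(3)] by blast
  have "v' = v" if "\<forall>w. g v' w = L w" for v'
  proof (rule ccontr)
    assume "v' \<noteq> v"
    then have "g (v' - v) (v' - v) > 0" using assms(2) by simp
    moreover have "g (v' - v) (v' - v) = 0"
      using 1 that bilinear_lsub[OF assms(1)] by simp
    ultimately show False by simp
  qed
  with 1 show ?thesis by blast
qed

theorem levi_civita_ex1:
  assumes M: "riemannian_manifold M" and i: "i \<in> idx M" and p: "p \<in> chart_dom M i"
  shows "\<exists>!\<Gamma>. levi_civita_at M i p \<Gamma>"
proof -
  define D where "D \<equiv> \<lambda>v w. dir_deriv M i (\<lambda>q. riem_metric M i q v w) p"
  have D: "bilinear (\<lambda>v w. D v w u)" "D v w = D w v" "linear (D v w)" for u v w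
    unfolding D_def by (rule metric_deriv[OF M i p])+
  let ?g = "riem_metric M i p"
  have bil: "bilinear ?g" and sym: "\<And>v w. ?g v w = ?g w v" and pos: "\<And>v. v \<noteq> 0 \<Longrightarrow> ?g v v > 0"
    using M i p unfolding riemannian_manifold_def by blast+
  define K where "K u v w = (D v w u + D u w v - D u v w) / 2" for u v w
  have Da: "D (x + y) v u = D x v u + D y v u" "D v (x + y) u = D v x u + D v y u"
    "D (c *\<^sub>R x) v u = c * D x v u" "D v (c *\<^sub>R x) u = c * D v x u"
    "D v w (x + y) = D v w x + D v w y" "D v w (c *\<^sub>R x) = c * D v w x" for u v w x y c
    using bilinear_ladd[OF D(1)[of u]] bilinear_radd[OF D(1)[of u]] bilinear_lmul[OF D(1)[of u]]
      bilinear_rmul[OF D(1)[of u]] linear_add[OF D(3)[of v w]] linear_scale[OF D(3)[of v w]] by auto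
  have "linear (K u v)" for u v
    by (rule linearI) (simp_all add: K_def Da algebra_simps add_divide_distrib diff_divide_distrib)
  note mus = musical[OF bil pos this]
  define \<Gamma> where "\<Gamma> u v = (THE x. \<forall>w. ?g x w = K u v w)" for u v
  have G: "?g (\<Gamma> u v) w = K u v w" for u v w
    using theI'[OF mus[of u v]] unfolding \<Gamma>_def by blast
  have eqI: "x = y" if "\<And>w. ?g x w = ?g y w" for x y
  proof (rule ccontr)
    assume "x \<noteq> y"
    then have "?g (x - y) (x - y) > 0" using pos by simp
    then show False using that by (simp add: bilinear_lsub[OF bil])
  qed
  have "bilinear \<Gamma>" unfolding bilinear_def
    by (auto intro!: linearI eqI simp: G bilinear_ladd[OF bil] bilinear_lmul[OF bil])
      (simp_all add: K_def Da algebra_simps add_divide_distrib diff_divide_distrib)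
  moreover have "\<Gamma> u v = \<Gamma> v u" for u v
    by (rule eqI) (simp add: G K_def D(2)[of u v])
  moreover have "D v w u = ?g (\<Gamma> u v) w + ?g v (\<Gamma> u w)" for u v w
    unfolding sym[of v "\<Gamma> u w"] G K_def using D(2)[of w v] by (simp add: field_simps)
  ultimately have ex: "levi_civita_at M i p \<Gamma>" unfolding levi_civita_at_def D_def by blast
  have "\<Gamma>' = \<Gamma>" if "levi_civita_at M i p \<Gamma>'" for \<Gamma>'
  proof -
    have s: "\<Gamma>' v w = \<Gamma>' w v" and m: "D v w u = ?g (\<Gamma>' u v) w + ?g v (\<Gamma>' u w)" for u v w
      using that unfolding levi_civita_at_def D_def by blast+
    have "?g (\<Gamma>' u v) w = K u v w" for u v w
      unfolding K_def m s[of v u] s[of w u] s[of w v] sym[of v "\<Gamma>' u w"] sym[of w] sym[of u] by simp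
    then show ?thesis by (intro ext eqI) (simp add: G)
  qed
  with ex show ?thesis by blast
qed


section \<open>The product of even-dimensional spin manifolds is a spin manifold\<close>

lemma kron_mult: "kron A B ** kron C D = kron (A ** C) (B ** D)"
  by (simp add: vec_eq_iff kron_def matrix_matrix_mult_def UNIV_Times_UNIV[symmetric]
      sum.cartesian_product' sum_product ac_simps del: UNIV_Times_UNIV)

lemma bilinear_kron: "bilinear kron"
  unfolding bilinear_def
  by (auto intro!: linearI simp: vec_eq_iff kron_def algebra_simps)

lemmas kron_add = bilinear_ladd[OF bilinear_kron] bilinear_radd[OF bilinear_kron]
lemmas kron_scaleR = bilinear_lmul[OF bilinear_kron] bilinear_rmul[OF bilinear_kron]
lemmas kron_zero = bilinear_lzero[OF bilinear_kron] bilinear_rzero[OF bilinear_kron]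

lemma kron_one: "kron (mat 1) (mat 1) = mat 1"
  by (auto simp: vec_eq_iff kron_def mat_def)

lemma kron_sum: "kron (sum f S) B = (\<Sum>k\<in>S. kron (f k) B)" "kron A (sum g S) = (\<Sum>k\<in>S. kron A (g k))"
  using linear_sum[of "\<lambda>A. kron A B" f S] linear_sum[of "kron A" g S] bilinear_kron unfolding bilinear_def by auto

lemma mat_radd: "(A + B) ** C = A ** C + B ** C" for A :: "complex^'n^'n"
  by (simp add: vec_eq_iff matrix_matrix_mult_def sum.distrib algebra_simps)

lemma mat_scaleR_simps:
  fixes A B :: "complex^'n^'n" and f :: "_ \<Rightarrow> complex^'n^'n"
  shows "(c *\<^sub>R A) ** B = c *\<^sub>R (A ** B)" "A ** (c *\<^sub>R B) = c *\<^sub>R (A ** B)"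
    "(sum f S) ** B = (\<Sum>k\<in>S. f k ** B)" "B ** (sum f S) = (\<Sum>k\<in>S. B ** f k)"
proof -
  have a: "(c *\<^sub>R A) ** B = c *\<^sub>R (A ** B)" "A ** (c *\<^sub>R B) = c *\<^sub>R (A ** B)" for c and A B :: "complex^'n^'n"
    by (simp_all add: vec_eq_iff matrix_matrix_mult_def scaleR_sum_right)
  have "linear (\<lambda>A :: complex^'n^'n. A ** B)" "linear (\<lambda>A :: complex^'n^'n. B ** A)" for B :: "complex^'n^'n"
    by (auto intro!: linearI simp: a matrix_add_ldistrib mat_radd)
  then show "(c *\<^sub>R A) ** B = c *\<^sub>R (A ** B)" "A ** (c *\<^sub>R B) = c *\<^sub>R (A ** B)" "(sum f S) ** B = (\<Sum>k\<in>S. f k ** B)" "B ** (sum f S) = (\<Sum>k\<in>S. B ** f k)"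
    using linear_sum[of "\<lambda>A. A ** B" f S] linear_sum[of "\<lambda>A. B ** A" f S] a by auto
qed

fun gprod where "gprod \<gamma> 0 = (mat 1 :: complex^'s^'s)" | "gprod \<gamma> (Suc n) = gprod \<gamma> n ** \<gamma> n"

lemma foldr_gprod: "foldr (**) (map \<gamma> [0..<n]) (mat 1) = gprod \<gamma> n"
proof -
  have "foldr (**) xs (a::complex^'s^'s) = foldr (**) xs (mat 1) ** a" for xs and a
    by (induction xs) (auto simp: matrix_mul_assoc)
  from this[of _ "\<gamma> _"] show ?thesis by (induction n) auto
qed

lemma spinor_moduleD:
  assumes "spinor_module n \<gamma>" "k < n" "l < n"
  shows "k \<noteq> l \<Longrightarrow> \<gamma> k ** \<gamma> l = - (\<gamma> l ** \<gamma> k)" "\<gamma> k ** \<gamma> k = - mat 1"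
proof -
  have *: "\<gamma> k ** \<gamma> l + \<gamma> l ** \<gamma> k = (if k = l then - mat 2 else 0)" if "k < n" "l < n" for k l
    using assms(1) that unfolding spinor_module_def by blast
  show "k \<noteq> l \<Longrightarrow> \<gamma> k ** \<gamma> l = - (\<gamma> l ** \<gamma> k)" using *[OF assms(2,3)] by (simp add: eq_neg_iff_add_eq_0)
  have "2 *\<^sub>R (\<gamma> k ** \<gamma> k) = 2 *\<^sub>R (- mat 1)" using *[OF assms(2,2)]
    by (simp add: scaleR_2 vec_eq_iff mat_def)
  then show "\<gamma> k ** \<gamma> k = - mat 1" by (simp only: scaleR_cancel_left) simp
qed

lemma matneg: "(- A) ** B = - (A ** B)" "A ** (- B) = - (A ** B)" for A B :: "complex^'n^'n"
  by (simp_all add: vec_eq_iff matrix_matrix_mult_def sum_negf)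

lemma gprod_comm:
  assumes \<gamma>: "spinor_module n \<gamma>" and "j \<le> n" "k < n"
  shows "\<gamma> k ** gprod \<gamma> j = (if k < j then - ((-1)^j *\<^sub>R (gprod \<gamma> j ** \<gamma> k)) else (-1)^j *\<^sub>R (gprod \<gamma> j ** \<gamma> k))"
  using assms(2)
proof (induction j)
  case 0 then show ?case by simp
next
  case (Suc j)
  have 1: "\<gamma> k ** gprod \<gamma> (Suc j) = (\<gamma> k ** gprod \<gamma> j) ** \<gamma> j" by (simp add: matrix_mul_assoc)
  have 2: "gprod \<gamma> j ** \<gamma> k ** \<gamma> j = (if k = j then 1 else -1) *\<^sub>R (gprod \<gamma> (Suc j) ** \<gamma> k)"
    using spinor_moduleD[OF \<gamma> \<open>k < n\<close>, of j] Suc.prems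
    by (auto simp: matrix_mul_assoc[symmetric] matneg)
  from 1 2 show ?case using Suc by (auto simp: matneg mat_scaleR_simps)
qed

lemma gprod_sq:
  assumes \<gamma>: "spinor_module n \<gamma>" and "2 * m \<le> n"
  shows "gprod \<gamma> (2 * m) ** gprod \<gamma> (2 * m) = (-1)^m *\<^sub>R mat 1"
  using assms(2)
proof (induction m)
  case 0 then show ?case by simp
next
  case (Suc m)
  let ?P = "gprod \<gamma> (2 * m)" and ?a = "\<gamma> (2 * m)" and ?b = "\<gamma> (Suc (2 * m))"
  have c: "?a ** ?P = ?P ** ?a" "?b ** ?P = ?P ** ?b"
    using gprod_comm[OF \<gamma>, of "2*m"] Suc.prems by auto
  have d: "?a ** ?a = - mat 1" "?b ** ?b = - mat 1" "?b ** ?a = - (?a ** ?b)"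
    by (rule spinor_moduleD(2)[OF \<gamma>, where l = 0] spinor_moduleD(1)[OF \<gamma>]; use Suc.prems in simp)+
  have "gprod \<gamma> (2 * Suc m) ** gprod \<gamma> (2 * Suc m) = ?P ** (?a ** (?b ** ?P)) ** (?a ** ?b)"
    by (simp add: matrix_mul_assoc)
  also have "\<dots> = ?P ** ((?a ** ?P) ** ?b) ** (?a ** ?b)" by (simp only: c matrix_mul_assoc)
  also have "\<dots> = (?P ** ?P) ** (?a ** (?b ** ?a) ** ?b)" by (simp only: c matrix_mul_assoc)
  also have "?a ** (?b ** ?a) ** ?b = - ((?a ** ?a) ** (?b ** ?b))"
    by (simp add: d(3) matneg matrix_mul_assoc)
  finally show ?case using Suc by (simp add: d matneg mat_scaleR_simps)
qed

lemma mat_c: "mat c ** A = A ** mat c" "mat c ** mat d = (mat (c * d) :: complex^'n^'n)" for A :: "complex^'n^'n"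
proof -
  have 1: "(mat c ** A) $ i $ j = c * A $ i $ j" for A :: "complex^'n^'n" and i j
  proof -
    have "(mat c ** A) $ i $ j = (\<Sum>k\<in>UNIV. if i = k then c * A $ k $ j else 0)"
      unfolding matrix_matrix_mult_def mat_def vec_lambda_beta by (rule sum.cong) auto
    then show ?thesis by simp
  qed
  have 2: "(A ** mat c) $ i $ j = c * A $ i $ j" for i j
  proof -
    have "(A ** mat c) $ i $ j = (\<Sum>k\<in>UNIV. if k = j then c * A $ i $ k else 0)"
      unfolding matrix_matrix_mult_def mat_def vec_lambda_beta by (rule sum.cong) auto
    then show ?thesis by simp
  qed
  show "mat c ** A = A ** mat c" by (simp add: vec_eq_iff 1 2)
  show "mat c ** mat d = (mat (c * d) :: complex^'n^'n)" unfolding vec_eq_iff 1 by (simp add: mat_def)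
qed

lemma volume_sq:
  assumes \<gamma>: "spinor_module n \<gamma>" and "even n"
  shows "volume_element n \<gamma> ** volume_element n \<gamma> = mat 1"
proof -
  obtain m where n: "n = 2 * m" using assms(2) by blast
  let ?c = "mat (\<i> ^ m) :: complex^'a^'a" and ?P = "gprod \<gamma> n"
  have "(?c ** ?P) ** (?c ** ?P) = (?c ** ?c) ** (?P ** ?P)"
  proof -
    have "(?c ** ?P) ** (?c ** ?P) = ?c ** (?P ** ?c) ** ?P" by (simp add: matrix_mul_assoc)
    also have "?P ** ?c = ?c ** ?P" by (rule mat_c(1)[symmetric])
    finally show ?thesis by (simp add: matrix_mul_assoc)
  qed
  also have "\<dots> = mat ((-1)^m) ** ((-1)^m *\<^sub>R mat 1)"
  proof -
    have "\<i> ^ m * \<i> ^ m = (-1) ^ m" by (metis i_squared power_mult_distrib)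
    then have "?c ** ?c = mat ((-1)^m)" by (simp only: mat_c(2))
    moreover have "?P ** ?P = (-1)^m *\<^sub>R mat 1" using gprod_sq[OF \<gamma>, of m] n by simp
    ultimately show ?thesis by simp
  qed
  also have "\<dots> = mat 1" proof (cases "even m")
    case False
    have "mat (-1) = (- mat 1 :: complex^'a^'a)" by (simp add: vec_eq_iff mat_def)
    with False show ?thesis by (simp add: matneg)
  qed simp
  finally have "(?c ** ?P) ** (?c ** ?P) = mat 1" .
  moreover have "n div 2 = m" using n by simp
  ultimately show ?thesis unfolding volume_element_def foldr_gprod by metis
qed

lemma volume_anti:
  assumes \<gamma>: "spinor_module n \<gamma>" and "even n" "k < n"
  shows "\<gamma> k ** volume_element n \<gamma> = - (volume_element n \<gamma> ** \<gamma> k)"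
proof -
  have "\<gamma> k ** gprod \<gamma> n = - (gprod \<gamma> n ** \<gamma> k)"
    using gprod_comm[OF \<gamma> order_refl assms(3)] assms(2,3) by simp
  moreover have "\<gamma> k ** (mat c ** gprod \<gamma> n) = mat c ** (\<gamma> k ** gprod \<gamma> n)" for c
    using mat_c(1)[of c "\<gamma> k"] by (simp add: matrix_mul_assoc)
  ultimately show ?thesis
    unfolding volume_element_def foldr_gprod by (simp add: matneg matrix_mul_assoc)
qed

lemma spinor_module_prod:
  assumes "spinor_module n1 \<gamma>1" "spinor_module n2 \<gamma>2" "even n1" "even n2"
  shows "spinor_module (n1 + n2) (gam_prod n1 \<gamma>1 \<gamma>2)"
proof -
  have 0: "CARD('a \<times> 'b) = 2 ^ ((n1 + n2) div 2)"
    using assms unfolding spinor_module_def by (auto simp: power_add[symmetric] elim!: evenE)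
  have n: "kron (- A) B = - kron A B" "kron A (- B) = - kron A B" for A :: "complex^'a^'a" and B :: "complex^'b^'b"
    by (simp_all add: vec_eq_iff kron_def)
  have 1: "gam_prod n1 \<gamma>1 \<gamma>2 k ** gam_prod n1 \<gamma>1 \<gamma>2 l + gam_prod n1 \<gamma>1 \<gamma>2 l ** gam_prod n1 \<gamma>1 \<gamma>2 k = 
      (if k = l then - mat 2 else 0)" if "k < n1 + n2" "l < n1 + n2" for k l
  proof -
    have t: "kron (mat 2) (mat 1) = mat 2" "kron (mat 1) (mat 2) = mat 2" 
      "2 * kron (mat 1) (mat 1) = mat 2"
      by (auto simp: vec_eq_iff kron_def mat_def)
    have r1: "\<gamma>1 k ** \<gamma>1 l + \<gamma>1 l ** \<gamma>1 k = (if k = l then - mat 2 else 0)" if "k < n1" "l < n1"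
      using assms(1) that unfolding spinor_module_def by blast
    have r2: "\<gamma>2 (k-n1) ** \<gamma>2 (l-n1) + \<gamma>2 (l-n1) ** \<gamma>2 (k-n1) = (if k-n1 = l-n1 then - mat 2 else 0)" if "\<not> k < n1" "\<not> l < n1"
      using assms(2) \<open>k < n1 + n2\<close> \<open>l < n1 + n2\<close> that unfolding spinor_module_def by force
    have s: "l < n1 \<Longrightarrow> \<gamma>1 l ** \<gamma>1 l = - mat 1" "\<not> l < n1 \<Longrightarrow> \<gamma>2 (l-n1) ** \<gamma>2 (l-n1) = - mat 1"
      using spinor_moduleD(2)[OF assms(1), of l l] spinor_moduleD(2)[OF assms(2), of "l-n1" "l-n1"] that by auto
    show ?thesis
      by (auto simp: s gam_prod_def kron_mult kron_add[symmetric] volume_sq[OF assms(1,3)] 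
          volume_anti[OF assms(1,3)] n r1 r2 t kron_zero)
  qed
  show ?thesis unfolding spinor_module_def by (intro conjI allI impI 0 1)
qed

lemma spin_group_mult:
  assumes "s \<in> spin_group n \<gamma>" "t \<in> spin_group n \<gamma>" shows "s ** t \<in> spin_group n \<gamma>"
  using assms(2)
proof induction
  case (mult s' u v)
  show ?case using spin_group.mult[OF mult.IH mult.hyps(2,3)] by (simp add: matrix_mul_assoc)
qed (simp add: assms(1))

lemma sum_split: "(\<Sum>k<n1+n2. f k) = (\<Sum>k<n1. f k) + (\<Sum>k<n2. f (n1 + k))" for f :: "nat \<Rightarrow> 'z::comm_monoid_add"
  by (induction n2) (auto simp: ac_simps)

lemma cv_prod: "clifford_vec (n1 + n2) (gam_prod n1 \<gamma>1 \<gamma>2) u =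
   kron (clifford_vec n1 \<gamma>1 u) (mat 1) + kron (volume_element n1 \<gamma>1) (clifford_vec n2 \<gamma>2 (\<lambda>k. u (n1 + k)))"
  unfolding clifford_vec_def sum_split kron_sum
  by (intro arg_cong2[of _ _ _ _ "(+)"] sum.cong refl) (auto simp: kron_scaleR gam_prod_def)

lemma cv0: "clifford_vec n \<gamma> (\<lambda>_. 0) = 0" by (simp add: clifford_vec_def)
lemma cv_cong: "(\<And>k. k < n \<Longrightarrow> u k = v k) \<Longrightarrow> clifford_vec n \<gamma> u = clifford_vec n \<gamma> v" by (simp add: clifford_vec_def)

lemma spin_group_kron:
  assumes \<gamma>: "spinor_module n1 \<gamma>1" "even n1" and s: "s \<in> spin_group n1 \<gamma>1" and t: "t \<in> spin_group n2 \<gamma>2"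
  shows "kron s t \<in> spin_group (n1 + n2) (gam_prod n1 \<gamma>1 \<gamma>2)"
proof -
  have 1: "kron s (mat 1) \<in> spin_group (n1 + n2) (gam_prod n1 \<gamma>1 \<gamma>2)"
    using s
  proof induction
    case one show ?case by (simp add: kron_one spin_group.one)
  next
    case (mult s u v)
    let ?e = "\<lambda>u k. if k < n1 then u k else (0::real)"
    have "clifford_vec (n1+n2) (gam_prod n1 \<gamma>1 \<gamma>2) (?e u) = kron (clifford_vec n1 \<gamma>1 u) (mat 1)" for u
      unfolding cv_prod using cv_cong[of n1 "?e u" u \<gamma>1] by (simp add: cv0 kron_zero)
    moreover have "(\<Sum>k<n1+n2. (?e u k)\<^sup>2) = (\<Sum>k<n1. (u k)\<^sup>2)" for u by (simp add: sum_split)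
    ultimately show ?case
      using spin_group.mult[OF mult.IH, of "?e u" "?e v"] mult.hyps
      by (simp add: kron_mult)
  qed
  have 2: "kron (mat 1) t \<in> spin_group (n1 + n2) (gam_prod n1 \<gamma>1 \<gamma>2)"
    using t
  proof induction
    case one show ?case by (simp add: kron_one spin_group.one)
  next
    case (mult s u v)
    let ?e = "\<lambda>u k. if k < n1 then (0::real) else u (k - n1)"
    have "clifford_vec (n1+n2) (gam_prod n1 \<gamma>1 \<gamma>2) (?e u) = kron (volume_element n1 \<gamma>1) (clifford_vec n2 \<gamma>2 u)" for u
      unfolding cv_prod using cv_cong[of n1 "?e u" "\<lambda>_. 0" \<gamma>1] by (simp add: cv0 kron_zero)
    moreover have "(\<Sum>k<n1+n2. (?e u k)\<^sup>2) = (\<Sum>k<n2. (u k)\<^sup>2)" for u by (simp add: sum_split)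
    ultimately show ?case
      using spin_group.mult[OF mult.IH, of "?e u" "?e v"] mult.hyps
      by (simp add: kron_mult volume_sq[OF \<gamma>])
  qed
  show ?thesis using spin_group_mult[OF 1 2] by (simp add: kron_mult)
qed

lemma spin_group_volume:
  assumes \<gamma>: "spinor_module n \<gamma>" "even n" and s: "s \<in> spin_group n \<gamma>"
  shows "s ** volume_element n \<gamma> = volume_element n \<gamma> ** s"
proof -
  let ?w = "volume_element n \<gamma>"
  have a: "clifford_vec n \<gamma> u ** ?w = - (?w ** clifford_vec n \<gamma> u)" for u
    unfolding clifford_vec_def
    by (simp add: mat_scaleR_simps volume_anti[OF \<gamma>] matneg sum_negf)
  show ?thesis using s
  proof induction
    case one show ?case by simp
  next
    case (mult s u v)
    let ?u = "clifford_vec n \<gamma> u" and ?v = "clifford_vec n \<gamma> v"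
    have "s ** (?u ** ?v) ** ?w = s ** (?u ** (?v ** ?w))" by (simp add: matrix_mul_assoc)
    also have "\<dots> = - (s ** ((?u ** ?w) ** ?v))" by (simp add: a matneg matrix_mul_assoc)
    also have "\<dots> = (s ** ?w) ** (?u ** ?v)" by (simp add: a matneg matrix_mul_assoc)
    finally show ?case using mult.IH by (simp add: matrix_mul_assoc)
  qed
qed

lemma Ck_cong:
  assumes "open S" "Ck_on n f S" "\<And>x. x \<in> S \<Longrightarrow> f x = g x"
  shows "Ck_on n g S"
  using assms(2,3)
proof (induction n arbitrary: f g)
  case 0 then show ?case using continuous_on_cong by (metis Ck_on.simps(1))
next
  case (Suc n)
  note * = frechet_cong[OF assms(1) _ Suc.prems(2)]
  show ?case unfolding Ck_on.simps(2)
  proof (intro conjI ballI allI)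
    show "g differentiable (at x)" if "x \<in> S" for x using * that Suc.prems(1) by auto
    show "Ck_on n (\<lambda>x. frechet_derivative g (at x) v) S" for v
    proof (rule Suc.IH)
      show "Ck_on n (\<lambda>x. frechet_derivative f (at x) v) S" using Suc.prems(1) by simp
      show "frechet_derivative f (at x) v = frechet_derivative g (at x) v" if "x \<in> S" for x
        using *(2)[OF that] Suc.prems(1) that by simp
    qed
  qed
qed

lemma Ck_SucI:
  assumes "open S" "\<And>x. x \<in> S \<Longrightarrow> (f has_derivative f' x) (at x)" "\<And>v. Ck_on n (\<lambda>x. f' x v) S"
  shows "Ck_on (Suc n) f S"
  unfolding Ck_on.simps(2)
proof (intro conjI ballI allI)
  show "f differentiable (at x)" if "x \<in> S" for x using assms(2)[OF that] differentiable_def by blast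
  show "Ck_on n (\<lambda>x. frechet_derivative f (at x) v) S" for v
    by (rule Ck_cong[OF assms(1,3)]) (use frechet_derivative_at[OF assms(2)] in simp)
qed

lemma Ck_SucD:
  assumes "Ck_on (Suc n) f S"
  shows "x \<in> S \<Longrightarrow> (f has_derivative frechet_derivative f (at x)) (at x)"
    "Ck_on n (\<lambda>x. frechet_derivative f (at x) v) S"
  using assms frechet_derivative_works by auto

lemma Ck_mono1: "Ck_on (Suc n) f S \<Longrightarrow> Ck_on n f S"
proof (induction n arbitrary: f)
  case 0 then show ?case
    by (auto intro!: differentiable_imp_continuous_on simp: differentiable_on_def differentiable_at_withinI)
next
  case (Suc n) then show ?case by (metis Ck_on.simps(2))
qed

lemma Ck_const: "open S \<Longrightarrow> Ck_on n (\<lambda>x. c) S"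
proof (induction n arbitrary: c)
  case (Suc n) then show ?case by (intro Ck_SucI[where f' = "\<lambda>x v. 0"]) auto
qed simp

lemma Ck_add: "open S \<Longrightarrow> Ck_on n f S \<Longrightarrow> Ck_on n g S \<Longrightarrow> Ck_on n (\<lambda>x. f x + g x) S"
proof (induction n arbitrary: f g)
  case 0 then show ?case by (auto intro: continuous_on_add)
next
  case (Suc n)
  show ?case
    by (rule Ck_SucI[OF Suc.prems(1) has_derivative_add[OF Ck_SucD(1)[OF Suc.prems(2)] Ck_SucD(1)[OF Suc.prems(3)]]
          Suc.IH[OF Suc.prems(1) Ck_SucD(2)[OF Suc.prems(2)] Ck_SucD(2)[OF Suc.prems(3)]]])
qed

lemma Ck_bilinear:
  assumes "open S" "bounded_bilinear h"
  shows "Ck_on n f S \<Longrightarrow> Ck_on n g S \<Longrightarrow> Ck_on n (\<lambda>x. h (f x) (g x)) S"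
proof (induction n arbitrary: f g)
  case 0 then show ?case unfolding Ck_on.simps(1) by (intro bounded_bilinear.continuous_on[OF assms(2)])
next
  case (Suc n)
  show ?case
    by (rule Ck_SucI[OF assms(1) bounded_bilinear.FDERIV[OF assms(2) Ck_SucD(1)[OF Suc.prems(1)] Ck_SucD(1)[OF Suc.prems(2)]]])
      (assumption+, rule Ck_add[OF assms(1) Suc.IH[OF Ck_mono1[OF Suc.prems(1)] Ck_SucD(2)[OF Suc.prems(2)]]
            Suc.IH[OF Ck_SucD(2)[OF Suc.prems(1)] Ck_mono1[OF Suc.prems(2)]]])
qed

lemma Ck_linear:
  assumes "open S" "bounded_linear h"
  shows "Ck_on n f S \<Longrightarrow> Ck_on n (\<lambda>x. h (f x)) S"
proof (induction n arbitrary: f)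
  case 0 then show ?case unfolding Ck_on.simps(1) by (intro bounded_linear.continuous_on[OF assms(2)])
next
  case (Suc n)
  show ?case
    by (rule Ck_SucI[OF assms(1) bounded_linear.has_derivative[OF assms(2) Ck_SucD(1)[OF Suc.prems]]
          Suc.IH[OF Ck_SucD(2)[OF Suc.prems]]])
qed

lemma Ck_comp_linear:
  assumes "open S" "open T" "bounded_linear L" "\<And>x. x \<in> T \<Longrightarrow> L x \<in> S"
  shows "Ck_on n f S \<Longrightarrow> Ck_on n (\<lambda>x. f (L x)) T"
proof (induction n arbitrary: f)
  case 0
  then have "continuous_on S f" by simp
  from continuous_on_compose2[OF this linear_continuous_on[OF assms(3)]] show ?case
    unfolding Ck_on.simps(1) using assms(4) by blast
next
  case (Suc n)
  show ?case
  proof (rule Ck_SucI[OF assms(2)])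
    show "((\<lambda>x. f (L x)) has_derivative (\<lambda>v. frechet_derivative f (at (L x)) (L v))) (at x)" if "x \<in> T" for x
      using has_derivative_compose[OF bounded_linear_imp_has_derivative[OF assms(3)] Ck_SucD(1)[OF Suc.prems assms(4)[OF that]]]
      by simp
    show "Ck_on n (\<lambda>x. frechet_derivative f (at (L x)) (L v)) T" for v
      using Suc.IH[OF Ck_SucD(2)[OF Suc.prems]] .
  qed
qed

lemma smooth_cong: "open S \<Longrightarrow> smooth_on f S \<Longrightarrow> (\<And>x. x \<in> S \<Longrightarrow> f x = g x) \<Longrightarrow> smooth_on g S"
  unfolding smooth_on_def using Ck_cong by blast
lemma smooth_add: "open S \<Longrightarrow> smooth_on f S \<Longrightarrow> smooth_on g S \<Longrightarrow> smooth_on (\<lambda>x. f x + g x) S"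
  unfolding smooth_on_def using Ck_add by blast
lemma smooth_bilinear: "open S \<Longrightarrow> bounded_bilinear h \<Longrightarrow> smooth_on f S \<Longrightarrow> smooth_on g S \<Longrightarrow> smooth_on (\<lambda>x. h (f x) (g x)) S"
  unfolding smooth_on_def using Ck_bilinear by blast
lemma smooth_linear: "open S \<Longrightarrow> bounded_linear h \<Longrightarrow> smooth_on f S \<Longrightarrow> smooth_on (\<lambda>x. h (f x)) S"
  unfolding smooth_on_def using Ck_linear by blast
lemma smooth_fst: "open S \<Longrightarrow> open T \<Longrightarrow> smooth_on f S \<Longrightarrow> smooth_on (\<lambda>z. f (fst z)) (S \<times> T)"
  unfolding smooth_on_def by (intro allI Ck_comp_linear[where S = S and L = fst] open_Times bounded_linear_fst) auto
lemma smooth_snd: "open S \<Longrightarrow> open T \<Longrightarrow> smooth_on f T \<Longrightarrow> smooth_on (\<lambda>z. f (snd z)) (S \<times> T)"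
  unfolding smooth_on_def by (intro allI Ck_comp_linear[where S = T and L = snd] open_Times bounded_linear_snd) auto
lemma smooth_diff: "smooth_on f S \<Longrightarrow> x \<in> S \<Longrightarrow> (f has_derivative frechet_derivative f (at x)) (at x)"
  unfolding smooth_on_def using Ck_SucD(1) by blast

lemma bl_Pair: "bounded_linear (\<lambda>x::'x::real_normed_vector. (x, 0::'y::real_normed_vector))"
   "bounded_linear (\<lambda>x::'x::real_normed_vector. (0::'y::real_normed_vector, x))"
  by (rule bounded_linear_Pair[OF bounded_linear_ident bounded_linear_zero] bounded_linear_Pair[OF bounded_linear_zero bounded_linear_ident])+

lemma smooth_Pair0:
  assumes "open S" "open T"
  shows "smooth_on f S \<Longrightarrow> smooth_on (\<lambda>z. (f (fst z), 0::'y::real_normed_vector)) (S \<times> T)"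
    "smooth_on g T \<Longrightarrow> smooth_on (\<lambda>z. (0::'y::real_normed_vector, g (snd z))) (S \<times> T)"
  using smooth_linear[OF open_Times[OF assms] bl_Pair(1) smooth_fst[OF assms]]
   smooth_linear[OF open_Times[OF assms] bl_Pair(2) smooth_snd[OF assms]] by blast+

lemma smooth_Pair:
  assumes "open S" "open T" "smooth_on f S" "smooth_on g T"
  shows "smooth_on (\<lambda>z. (f (fst z), g (snd z))) (S \<times> T)"
  using smooth_add[OF open_Times[OF assms(1,2)] smooth_Pair0(1)[OF assms(1,2,3)] smooth_Pair0(2)[OF assms(1,2,4)]]
  by simp

lemmas rs1 = riemannian_spin_manifold_def[THEN iffD1, THEN conjunct1]
lemmas rs2 = riemannian_spin_manifold_def[THEN iffD1, THEN conjunct2, THEN conjunct1, rule_format]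
lemmas rs3 = riemannian_spin_manifold_def[THEN iffD1, THEN conjunct2, THEN conjunct2, THEN conjunct1, rule_format]
lemmas rs4 = riemannian_spin_manifold_def[THEN iffD1, THEN conjunct2, THEN conjunct2, THEN conjunct2, THEN conjunct1, rule_format]
lemmas rs5 = riemannian_spin_manifold_def[THEN iffD1, THEN conjunct2, THEN conjunct2, THEN conjunct2, THEN conjunct2, THEN conjunct1, rule_format]
lemmas rs6 = riemannian_spin_manifold_def[THEN iffD1, THEN conjunct2, THEN conjunct2, THEN conjunct2, THEN conjunct2, THEN conjunct2, THEN conjunct1, rule_format]
lemmas rs7 = riemannian_spin_manifold_def[THEN iffD1, THEN conjunct2, THEN conjunct2, THEN conjunct2, THEN conjunct2, THEN conjunct2, THEN conjunct2, rule_format]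
lemmas sf1 = smooth_manifold_def[THEN iffD1, THEN conjunct1, rule_format]
lemmas sf2 = smooth_manifold_def[THEN iffD1, THEN conjunct2, THEN conjunct1, rule_format]
lemmas sf3 = smooth_manifold_def[THEN iffD1, THEN conjunct2, THEN conjunct2, rule_format]
lemmas rm1 = riemannian_manifold_def[THEN iffD1, THEN conjunct1, rule_format]
lemmas rm2 = riemannian_manifold_def[THEN iffD1, THEN conjunct2, THEN conjunct1, rule_format]
lemmas rm3 = riemannian_manifold_def[THEN iffD1, THEN conjunct2, THEN conjunct2, THEN conjunct1, rule_format]
lemmas rm4 = riemannian_manifold_def[THEN iffD1, THEN conjunct2, THEN conjunct2, THEN conjunct2, rule_format]

context
  fixes M1 :: "('a::{t2_space, second_countable_topology}, 'i, 'e::euclidean_space, 's::finite) spin_atlas"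
    and M2 :: "('b::{t2_space, second_countable_topology}, 'j, 'f::euclidean_space, 't::finite) spin_atlas"
  assumes M1: "riemannian_spin_manifold M1" and M2: "riemannian_spin_manifold M2"
    and ev: "even DIM('e)" "even DIM('f)"
begin

lemma sm: "smooth_manifold M1" "smooth_manifold M2" "riemannian_manifold M1" "riemannian_manifold M2"
  using rs1[OF M1] rs1[OF M2] rm1[OF rs1[OF M1]] rm1[OF rs1[OF M2]] by auto

lemma chartD:
  assumes "smooth_manifold M" "i \<in> idx M"
  shows "open (chart_dom M i)" "open (chart M i ` chart_dom M i)" "inj_on (chart M i) (chart_dom M i)"
    "continuous_on (chart_dom M i) (chart M i)" "continuous_on (chart M i ` chart_dom M i) (inv_into (chart_dom M i) (chart M i))"
  using sf2[OF assms] unfolding homeomorphism_def by (simp, simp, metis inj_on_inverseI, simp, simp)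

lemma chart_open:
  assumes "smooth_manifold M" "i \<in> idx M" "open W"
  shows "open (chart M i ` (chart_dom M i \<inter> W))"
proof -
  have "homeomorphism (chart_dom M i) (chart M i ` chart_dom M i) (chart M i) (inv_into (chart_dom M i) (chart M i))"
    using sf2[OF assms(1,2)] by simp
  then have "openin (top_of_set (chart M i ` chart_dom M i)) (chart M i ` (chart_dom M i \<inter> W))"
    by (rule homeomorphism_imp_open_map) (use assms(3) in \<open>auto simp: openin_open\<close>)
  then show ?thesis using chartD(2)[OF assms(1,2)] openin_open_trans by blast
qed

lemma inv_prod:
  assumes "i \<in> idx M1" "j \<in> idx M2" "x \<in> chart M1 i ` chart_dom M1 i" "y \<in> chart M2 j ` chart_dom M2 j"
  shows "inv_into (chart_dom (spin_product M1 M2) (i,j)) (chart (spin_product M1 M2) (i,j)) (x,y)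
   = (inv_into (chart_dom M1 i) (chart M1 i) x, inv_into (chart_dom M2 j) (chart M2 j) y)"
proof -
  obtain p q where p: "p \<in> chart_dom M1 i" "x = chart M1 i p" and q: "q \<in> chart_dom M2 j" "y = chart M2 j q" using assms by auto
  note inj = chartD(3)[OF sm(1) assms(1)] chartD(3)[OF sm(2) assms(2)]
  have "inj_on (chart (spin_product M1 M2) (i,j)) (chart_dom (spin_product M1 M2) (i,j))"
    using inj by (auto simp: spin_product_def inj_on_def)
  from inv_into_f_f[OF this, of "(p,q)"] show ?thesis
    using p q inj by (simp add: spin_product_def)
qed

lemma img_prod: 
  "chart (spin_product M1 M2) (i,j) ` (A \<times> B) = (chart M1 i ` A) \<times> (chart M2 j ` B)"
  by (force simp: spin_product_def)

lemma dom_prod: "chart_dom (spin_product M1 M2) (i,j) = chart_dom M1 i \<times> chart_dom M2 j" "idx (spin_product M1 M2) = idx M1 \<times> idx M2"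
  by (simp_all add: spin_product_def)

lemma in_chart_prod:
  assumes "i \<in> idx M1" "j \<in> idx M2" "x \<in> chart M1 i ` chart_dom M1 i" "y \<in> chart M2 j ` chart_dom M2 j"
  shows "in_chart (spin_product M1 M2) (i,j) F (x,y) 
    = F (inv_into (chart_dom M1 i) (chart M1 i) x, inv_into (chart_dom M2 j) (chart M2 j) y)"
  unfolding in_chart_def using inv_prod[OF assms] by simp

lemma in_chart_chart_prod:
  assumes "i \<in> idx M1" "j \<in> idx M2" "fst z \<in> chart M1 i ` chart_dom M1 i" "snd z \<in> chart M2 j ` chart_dom M2 j"
  shows "(in_chart M1 i (chart M1 i') (fst z), in_chart M2 j (chart M2 j') (snd z)) =
         in_chart (spin_product M1 M2) (i, j) (chart (spin_product M1 M2) (i', j')) z"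
proof -
  have "chart (spin_product M1 M2) (i', j') (p, q) = (chart M1 i' p, chart M2 j' q)" for p q
    by (simp add: spin_product_def)
  with in_chart_prod[OF assms, of "chart (spin_product M1 M2) (i', j')"] show ?thesis by (simp add: in_chart_def)
qed

lemma smooth_manifold_prod: "smooth_manifold (spin_product M1 M2)"
  unfolding smooth_manifold_def
proof (intro conjI ballI)
  show "(\<Union>i\<in>idx (spin_product M1 M2). chart_dom (spin_product M1 M2) i) = UNIV"
  proof -
    have "\<exists>i\<in>idx M1. p \<in> chart_dom M1 i" "\<exists>j\<in>idx M2. q \<in> chart_dom M2 j" for p q
      using sf1[OF sm(1)] sf1[OF sm(2)] by auto
    then show ?thesis by (fastforce simp: dom_prod)
  qed
  fix c assume "c \<in> idx (spin_product M1 M2)"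
  then obtain i j where c: "c = (i,j)" "i \<in> idx M1" "j \<in> idx M2" by (auto simp: dom_prod)
  note C1 = chartD[OF sm(1) c(2)] and C2 = chartD[OF sm(2) c(3)]
  show "open (chart_dom (spin_product M1 M2) c)" using C1 C2 by (simp add: c dom_prod open_Times)
  show "open (chart (spin_product M1 M2) c ` chart_dom (spin_product M1 M2) c)" 
    using C1 C2 by (simp add: c dom_prod img_prod open_Times)
  show "homeomorphism (chart_dom (spin_product M1 M2) c) (chart (spin_product M1 M2) c ` chart_dom (spin_product M1 M2) c)
      (chart (spin_product M1 M2) c) (inv_into (chart_dom (spin_product M1 M2) c) (chart (spin_product M1 M2) c))"
    unfolding homeomorphism_def
  proof (intro conjI)
    let ?A = "chart_dom (spin_product M1 M2) c" and ?f = "chart (spin_product M1 M2) c"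
    have inj: "inj_on ?f ?A" using C1(3) C2(3) by (auto simp: c spin_product_def inj_on_def)
    show "\<forall>x\<in>?A. inv_into ?A ?f (?f x) = x" using inj by simp
    show "?f ` ?A = ?f ` ?A" ..
    show "continuous_on ?A ?f"
    proof -
      have "continuous_on ?A (\<lambda>z. (chart M1 i (fst z), chart M2 j (snd z)))"
        by (intro continuous_on_Pair continuous_on_compose2[OF C1(4)] continuous_on_compose2[OF C2(4)]
            continuous_on_fst continuous_on_snd continuous_on_id) (auto simp: c dom_prod)
      then show ?thesis by (simp add: c spin_product_def case_prod_unfold)
    qed
    show "inv_into ?A ?f ` ?f ` ?A = ?A" using inj by (simp add: image_image)
    show "\<forall>y\<in>?f ` ?A. ?f (inv_into ?A ?f y) = y" by (intro ballI f_inv_into_f)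
    show "continuous_on (?f ` ?A) (inv_into ?A ?f)"
    proof -
      have "continuous_on (?f ` ?A) (\<lambda>z. (inv_into (chart_dom M1 i) (chart M1 i) (fst z), inv_into (chart_dom M2 j) (chart M2 j) (snd z)))"
        by (intro continuous_on_Pair continuous_on_compose2[OF C1(5)] continuous_on_compose2[OF C2(5)]
            continuous_on_fst continuous_on_snd continuous_on_id) (auto simp: c dom_prod img_prod)
      then show ?thesis
        by (rule continuous_on_eq) (auto simp: c dom_prod img_prod inv_prod[OF c(2,3), unfolded dom_prod])
    qed
  qed
  fix c' assume "c' \<in> idx (spin_product M1 M2)"
  then obtain i' j' where c': "c' = (i',j')" "i' \<in> idx M1" "j' \<in> idx M2" by (auto simp: dom_prod)
  have "smooth_on (in_chart M1 i (chart M1 i')) (chart M1 i ` (chart_dom M1 i \<inter> chart_dom M1 i'))"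
     "smooth_on (in_chart M2 j (chart M2 j')) (chart M2 j ` (chart_dom M2 j \<inter> chart_dom M2 j'))"
    using sf3[OF sm(1)] sf3[OF sm(2)] c c' by auto
  note * = smooth_Pair[OF chart_open[OF sm(1) c(2) chartD(1)[OF sm(1) c'(2)]]
      chart_open[OF sm(2) c(3) chartD(1)[OF sm(2) c'(3)]] this]
  show "smooth_on (in_chart (spin_product M1 M2) c (chart (spin_product M1 M2) c'))
           (chart (spin_product M1 M2) c ` (chart_dom (spin_product M1 M2) c \<inter> chart_dom (spin_product M1 M2) c'))"
    unfolding c c' dom_prod Times_Int_Times img_prod
  proof (rule smooth_cong[OF _ *])
    show "open (chart M1 i ` (chart_dom M1 i \<inter> chart_dom M1 i') \<times> chart M2 j ` (chart_dom M2 j \<inter> chart_dom M2 j'))"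
      by (intro open_Times chart_open sm chartD(1) c c')
    fix z assume "z \<in> chart M1 i ` (chart_dom M1 i \<inter> chart_dom M1 i') \<times> chart M2 j ` (chart_dom M2 j \<inter> chart_dom M2 j')"
    then have "fst z \<in> chart M1 i ` chart_dom M1 i" "snd z \<in> chart M2 j ` chart_dom M2 j" by auto
    with c(2,3) show "(in_chart M1 i (chart M1 i') (fst z), in_chart M2 j (chart M2 j') (snd z)) =
         in_chart (spin_product M1 M2) (i, j) (chart (spin_product M1 M2) (i', j')) z"
      by (intro in_chart_chart_prod)
  qed
qed

lemma coord_change_prod:
  assumes c: "i \<in> idx M1" "j \<in> idx M2" and c': "i' \<in> idx M1" "j' \<in> idx M2"
    and p: "p \<in> chart_dom M1 i \<inter> chart_dom M1 i'" and q: "q \<in> chart_dom M2 j \<inter> chart_dom M2 j'"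
  shows "coord_change (spin_product M1 M2) (i,j) (i',j') (p,q) v = (coord_change M1 i i' p (fst v), coord_change M2 j j' q (snd v))"
proof -
  let ?A = "chart M1 i ` (chart_dom M1 i \<inter> chart_dom M1 i')" and ?B = "chart M2 j ` (chart_dom M2 j \<inter> chart_dom M2 j')"
  have s: "smooth_on (in_chart M1 i (chart M1 i')) ?A" "smooth_on (in_chart M2 j (chart M2 j')) ?B"
    using sf3[OF sm(1)] sf3[OF sm(2)] c c' by auto
  have o: "open (?A \<times> ?B)" by (intro open_Times chart_open sm chartD(1) c c')
  let ?z = "(chart M1 i p, chart M2 j q)"
  have d1: "(in_chart M1 i (chart M1 i') has_derivative coord_change M1 i i' p) (at (chart M1 i p))"
    using smooth_diff[OF s(1), of "chart M1 i p"] p unfolding coord_change_def dir_deriv_def[abs_def] by auto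
  have d2: "(in_chart M2 j (chart M2 j') has_derivative coord_change M2 j j' q) (at (chart M2 j q))"
    using smooth_diff[OF s(2), of "chart M2 j q"] q unfolding coord_change_def dir_deriv_def[abs_def] by auto
  have "((\<lambda>z. (in_chart M1 i (chart M1 i') (fst z), in_chart M2 j (chart M2 j') (snd z))) has_derivative
      (\<lambda>v. (coord_change M1 i i' p (fst v), coord_change M2 j j' q (snd v)))) (at ?z)"
    by (intro has_derivative_Pair has_derivative_compose[OF has_derivative_fst[OF has_derivative_ident]]
        has_derivative_compose[OF has_derivative_snd[OF has_derivative_ident]]) (simp_all add: d1 d2)
  then have "(in_chart (spin_product M1 M2) (i,j) (chart (spin_product M1 M2) (i',j')) has_derivative
      (\<lambda>v. (coord_change M1 i i' p (fst v), coord_change M2 j j' q (snd v)))) (at ?z)"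
  proof (rule has_derivative_transform_within_open[OF _ o])
    show "?z \<in> ?A \<times> ?B" using p q by blast
    fix z assume "z \<in> ?A \<times> ?B"
    then have "fst z \<in> chart M1 i ` chart_dom M1 i" "snd z \<in> chart M2 j ` chart_dom M2 j" by auto
    with c show "(in_chart M1 i (chart M1 i') (fst z), in_chart M2 j (chart M2 j') (snd z)) =
         in_chart (spin_product M1 M2) (i, j) (chart (spin_product M1 M2) (i', j')) z"
      by (intro in_chart_chart_prod)
  qed
  from frechet_derivative_at[OF this, symmetric] show ?thesis
    unfolding coord_change_def dir_deriv_def by (simp add: spin_product_def)
qed

lemma metric_prod: "riem_metric (spin_product M1 M2) (i,j) (p,q) v w = riem_metric M1 i p (fst v) (fst w) + riem_metric M2 j q (snd v) (snd w)"
  by (simp add: spin_product_def case_prod_unfold)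

lemma smooth_prodI:
  assumes c: "i \<in> idx M1" "j \<in> idx M2" "open U" "open V" "U \<subseteq> chart_dom M1 i" "V \<subseteq> chart_dom M2 j"
    and "smooth_on G (chart M1 i ` U \<times> chart M2 j ` V)"
    and "\<And>p q. p \<in> U \<Longrightarrow> q \<in> V \<Longrightarrow> G (chart M1 i p, chart M2 j q) = F (p,q)"
  shows "smooth_on (in_chart (spin_product M1 M2) (i,j) F) (chart (spin_product M1 M2) (i,j) ` (U \<times> V))"
  unfolding img_prod
proof (rule smooth_cong[OF _ assms(7)])
  have *: "chart_dom M1 i \<inter> U = U" "chart_dom M2 j \<inter> V = V" using c by auto
  show "open (chart M1 i ` U \<times> chart M2 j ` V)" 
    using chart_open[OF sm(1) c(1,3)] chart_open[OF sm(2) c(2,4)] unfolding * by (rule open_Times)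
  fix z assume "z \<in> chart M1 i ` U \<times> chart M2 j ` V"
  then obtain p q where z: "p \<in> U" "q \<in> V" "z = (chart M1 i p, chart M2 j q)" by auto
  then have "p \<in> chart_dom M1 i" "q \<in> chart_dom M2 j" using c by auto
  with z in_chart_prod[OF c(1,2), of "fst z" "snd z" F] assms(8)[OF z(1,2)]
  show "G z = in_chart (spin_product M1 M2) (i, j) F z"
    using chartD(3)[OF sm(1) c(1)] chartD(3)[OF sm(2) c(2)] by simp
qed

lemma open_img:
  assumes "i \<in> idx M1" "j \<in> idx M2" "i' \<in> idx M1" "j' \<in> idx M2"
  shows "open (chart M1 i ` chart_dom M1 i)" "open (chart M2 j ` chart_dom M2 j)"
    "open (chart M1 i ` (chart_dom M1 i \<inter> chart_dom M1 i'))" "open (chart M2 j ` (chart_dom M2 j \<inter> chart_dom M2 j'))"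
  by (intro chart_open chartD sm assms)+

lemma in_chart_chart:
  "smooth_manifold M \<Longrightarrow> i \<in> idx M \<Longrightarrow> p \<in> chart_dom M i \<Longrightarrow> in_chart M i F (chart M i p) = F p"
  using chartD(3)[of M i] by (simp add: in_chart_def)

lemma bbil_kron: "bounded_bilinear (kron :: complex^'s^'s \<Rightarrow> complex^'t^'t \<Rightarrow> _)"
  using bilinear_kron bilinear_conv_bounded_bilinear by blast

lemma riemannian_prod: "riemannian_manifold (spin_product M1 M2)"
  unfolding riemannian_manifold_def
proof (intro conjI ballI smooth_manifold_prod)
  fix c assume "c \<in> idx (spin_product M1 M2)"
  then obtain i j where c: "c = (i,j)" "i \<in> idx M1" "j \<in> idx M2" by (auto simp: dom_prod)
  {
    fix x assume "x \<in> chart_dom (spin_product M1 M2) c"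
    then obtain p q where x: "x = (p,q)" "p \<in> chart_dom M1 i" "q \<in> chart_dom M2 j" by (auto simp: dom_prod c)
    have 1: "bilinear (riem_metric M1 i p)" "\<And>v w. riem_metric M1 i p v w = riem_metric M1 i p w v" "\<And>v. v \<noteq> 0 \<Longrightarrow> riem_metric M1 i p v v > 0"
      using rm2[OF sm(3) c(2) x(2)] by auto
    have 2: "bilinear (riem_metric M2 j q)" "\<And>v w. riem_metric M2 j q v w = riem_metric M2 j q w v" "\<And>v. v \<noteq> 0 \<Longrightarrow> riem_metric M2 j q v v > 0"
      using rm2[OF sm(4) c(3) x(3)] by auto
    show "bilinear (riem_metric (spin_product M1 M2) c x)"
      using 1(1) 2(1) unfolding bilinear_def linear_iff by (auto simp: c x metric_prod algebra_simps)
    show "\<forall>v w. riem_metric (spin_product M1 M2) c x v w = riem_metric (spin_product M1 M2) c x w v"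
      by (simp add: c x metric_prod 1(2) 2(2))
    have "riem_metric M1 i p v v \<ge> 0" "riem_metric M2 j q w w \<ge> 0" for v w
      using 1(3)[of v] 2(3)[of w] bilinear_lzero[OF 1(1)] bilinear_lzero[OF 2(1)] by (force simp: le_less)+
    then show "\<forall>v. v \<noteq> 0 \<longrightarrow> riem_metric (spin_product M1 M2) c x v v > 0"
      using 1(3) 2(3) by (auto simp: c x metric_prod prod_eq_iff add_pos_nonneg add_nonneg_pos)
  }
  show "\<forall>v w. smooth_on (in_chart (spin_product M1 M2) c (\<lambda>p. riem_metric (spin_product M1 M2) c p v w))
              (chart (spin_product M1 M2) c ` chart_dom (spin_product M1 M2) c)"
    unfolding c dom_prod
  proof (intro allI)
    fix v w
    have s: "smooth_on (in_chart M1 i (\<lambda>p. riem_metric M1 i p (fst v) (fst w))) (chart M1 i ` chart_dom M1 i)"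
      "smooth_on (in_chart M2 j (\<lambda>p. riem_metric M2 j p (snd v) (snd w))) (chart M2 j ` chart_dom M2 j)"
      by (rule rm3[OF sm(3) c(2)] rm3[OF sm(4) c(3)])+
    note o = open_img[OF c(2,3,2,3)]
    show "smooth_on (in_chart (spin_product M1 M2) (i,j) (\<lambda>p. riem_metric (spin_product M1 M2) (i,j) p v w))
              (chart (spin_product M1 M2) (i,j) ` (chart_dom M1 i \<times> chart_dom M2 j))"
      by (rule smooth_prodI[OF c(2,3) _ _ _ _ smooth_add[OF _ smooth_fst[OF o(1,2) s(1)] smooth_snd[OF o(1,2) s(2)]]])
        (use c sm in \<open>auto simp: chartD(1) in_chart_chart metric_prod open_Times o\<close>)
  qed
  fix c' assume "c' \<in> idx (spin_product M1 M2)"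
  then obtain i' j' where c': "c' = (i',j')" "i' \<in> idx M1" "j' \<in> idx M2" by (auto simp: dom_prod)
  fix x assume "x \<in> chart_dom (spin_product M1 M2) c \<inter> chart_dom (spin_product M1 M2) c'"
  then obtain p q where x: "x = (p,q)" "p \<in> chart_dom M1 i \<inter> chart_dom M1 i'" "q \<in> chart_dom M2 j \<inter> chart_dom M2 j'"
    by (auto simp: dom_prod c c')
  have "riem_metric M1 i' p (coord_change M1 i i' p v) (coord_change M1 i i' p w) = riem_metric M1 i p v w"
    "riem_metric M2 j' q (coord_change M2 j j' q v') (coord_change M2 j j' q w') = riem_metric M2 j q v' w'" for v w v' w'
    by (rule rm4[OF sm(3) c(2) c'(2) x(2)] rm4[OF sm(4) c(3) c'(3) x(3)])+
  then show "\<forall>v w. riem_metric (spin_product M1 M2) c' x (coord_change (spin_product M1 M2) c c' x v) (coord_change (spin_product M1 M2) c c' x w)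
     = riem_metric (spin_product M1 M2) c x v w"
    using coord_change_prod[OF c(2,3) c'(2,3) x(2,3)] by (simp add: c c' x metric_prod)
qed

lemma frame_prod: "frame (spin_product M1 M2) k (i,j) (p,q) =
   (if k < DIM('e) then (frame M1 k i p, 0) else (0, frame M2 (k - DIM('e)) j q))"
  by (simp add: spin_product_def)

lemma lift_prod: "lift (spin_product M1 M2) (i,j) (i',j') (p,q) = kron (lift M1 i i' p) (lift M2 j j' q)"
  "gam (spin_product M1 M2) = gam_prod DIM('e) (gam M1) (gam M2)"
  by (simp_all add: spin_product_def)

theorem riemannian_spin_manifold_spin_product: "riemannian_spin_manifold (spin_product M1 M2)"
proof -
  let ?M = "spin_product M1 M2" and ?n1 = "DIM('e)" and ?n2 = "DIM('f)"
  have dim: "DIM('e \<times> 'f) = ?n1 + ?n2" by simp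
  have sp: "spinor_module ?n1 (gam M1)" "spinor_module ?n2 (gam M2)"
    by (rule rs2[OF M1] rs2[OF M2])+
  show ?thesis unfolding riemannian_spin_manifold_def dim
  proof (intro conjI ballI allI impI riemannian_prod)
    show "spinor_module (?n1 + ?n2) (gam ?M)" using spinor_module_prod[OF sp ev] by (simp add: lift_prod)
    fix c assume "c \<in> idx ?M"
    then obtain i j where c: "c = (i,j)" "i \<in> idx M1" "j \<in> idx M2" by (auto simp: dom_prod)
    show "smooth_on (in_chart ?M c (frame ?M k c)) (chart ?M c ` chart_dom ?M c)" if k: "k < ?n1 + ?n2" for k
    proof (cases "k < ?n1")
      case True
      have s: "smooth_on (in_chart M1 i (frame M1 k i)) (chart M1 i ` chart_dom M1 i)"
        by (rule rs3[OF M1 c(2) True])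
      note o = open_img[OF c(2,3,2,3)]
      have "smooth_on (\<lambda>z. (in_chart M1 i (frame M1 k i) (fst z), 0::'f)) (chart M1 i ` chart_dom M1 i \<times> chart M2 j ` chart_dom M2 j)"
        by (rule smooth_Pair0(1)[OF o(1,2) s])
      then show ?thesis unfolding c dom_prod
        by (rule smooth_prodI[OF c(2,3), rotated 4])
          (use c sm True in \<open>auto simp: chartD(1) in_chart_chart frame_prod\<close>)
    next
      case False
      then have k': "k - ?n1 < ?n2" using k by linarith
      have s: "smooth_on (in_chart M2 j (frame M2 (k - ?n1) j)) (chart M2 j ` chart_dom M2 j)"
        by (rule rs3[OF M2 c(3) k'])
      note o = open_img[OF c(2,3,2,3)]
      have "smooth_on (\<lambda>z. (0::'e, in_chart M2 j (frame M2 (k - ?n1) j) (snd z))) (chart M1 i ` chart_dom M1 i \<times> chart M2 j ` chart_dom M2 j)"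
        by (rule smooth_Pair0(2)[OF o(1,2) s])
      then show ?thesis unfolding c dom_prod
        by (rule smooth_prodI[OF c(2,3), rotated 4])
          (use c sm False in \<open>auto simp: chartD(1) in_chart_chart frame_prod\<close>)
    qed
    have on1: "riem_metric M1 i p (frame M1 k i p) (frame M1 l i p) = (if k = l then 1 else 0)"
      if "p \<in> chart_dom M1 i" "k < ?n1" "l < ?n1" for p k l
      by (rule rs4[OF M1 c(2) that])
    have on2: "riem_metric M2 j p (frame M2 k j p) (frame M2 l j p) = (if k = l then 1 else 0)"
      if "p \<in> chart_dom M2 j" "k < ?n2" "l < ?n2" for p k l
      by (rule rs4[OF M2 c(3) that])
    have b1: "bilinear (riem_metric M1 i p)" if "p \<in> chart_dom M1 i" for p
      using rm2[OF sm(3) c(2) that] by simp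
    have b2: "bilinear (riem_metric M2 j q)" if "q \<in> chart_dom M2 j" for q
      using rm2[OF sm(4) c(3) that] by simp
    note z = bilinear_lzero[OF b1] bilinear_rzero[OF b1] bilinear_lzero[OF b2] bilinear_rzero[OF b2]
    show "riem_metric ?M c x (frame ?M k c x) (frame ?M l c x) = (if k = l then 1 else 0)"
      if xd: "x \<in> chart_dom ?M c" and k: "k < ?n1 + ?n2" and l: "l < ?n1 + ?n2" for x k l
    proof -
      obtain p q where x: "x = (p,q)" "p \<in> chart_dom M1 i" "q \<in> chart_dom M2 j" using xd by (auto simp: c dom_prod)
      show ?thesis using k l
        by (cases "k < ?n1"; cases "l < ?n1") (auto simp: c x metric_prod frame_prod on1 on2 z)
    qed
    fix c' assume "c' \<in> idx ?M"
    then obtain i' j' where c': "c' = (i',j')" "i' \<in> idx M1" "j' \<in> idx M2" by (auto simp: dom_prod)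
    show "smooth_on (in_chart ?M c (lift ?M c c')) (chart ?M c ` (chart_dom ?M c \<inter> chart_dom ?M c'))"
    proof -
      have s: "smooth_on (in_chart M1 i (lift M1 i i')) (chart M1 i ` (chart_dom M1 i \<inter> chart_dom M1 i'))"
        "smooth_on (in_chart M2 j (lift M2 j j')) (chart M2 j ` (chart_dom M2 j \<inter> chart_dom M2 j'))"
        by (rule rs5[OF M1 c(2) c'(2)] rs5[OF M2 c(3) c'(3)])+
      note o = open_img(3,4)[OF c(2,3) c'(2,3)]
      show ?thesis unfolding c c' dom_prod Times_Int_Times
        by (rule smooth_prodI[OF c(2,3) _ _ _ _ smooth_bilinear[OF open_Times[OF o] bbil_kron smooth_fst[OF o s(1)] smooth_snd[OF o s(2)]]])
          (use c c' sm in \<open>auto simp: chartD(1) in_chart_chart lift_prod intro!: open_Int\<close>)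
    qed
    {
      fix x assume "x \<in> chart_dom ?M c \<inter> chart_dom ?M c'"
      then obtain p q where x: "x = (p,q)" "p \<in> chart_dom M1 i \<inter> chart_dom M1 i'" "q \<in> chart_dom M2 j \<inter> chart_dom M2 j'"
        by (auto simp: dom_prod c c')
      have L1: "lift M1 i i' p \<in> spin_group ?n1 (gam M1)"
        "\<And>l. l < ?n1 \<Longrightarrow> lift M1 i i' p ** gam M1 l =
           clifford_vec ?n1 (gam M1) (\<lambda>k. riem_metric M1 i p (frame M1 k i p) (coord_change M1 i' i p (frame M1 l i' p))) ** lift M1 i i' p"
        using rs6[OF M1 c(2) c'(2) x(2)] by auto
      have L2: "lift M2 j j' q \<in> spin_group ?n2 (gam M2)"
        "\<And>l. l < ?n2 \<Longrightarrow> lift M2 j j' q ** gam M2 l =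
           clifford_vec ?n2 (gam M2) (\<lambda>k. riem_metric M2 j q (frame M2 k j q) (coord_change M2 j' j q (frame M2 l j' q))) ** lift M2 j j' q"
        using rs6[OF M2 c(3) c'(3) x(3)] by auto
      show "lift ?M c c' x \<in> spin_group (?n1 + ?n2) (gam ?M)"
        using spin_group_kron[OF sp(1) ev(1) L1(1) L2(1)] by (simp add: c c' x lift_prod)
      fix l assume l: "l < ?n1 + ?n2"
      have p: "p \<in> chart_dom M1 i' \<inter> chart_dom M1 i" "q \<in> chart_dom M2 j' \<inter> chart_dom M2 j" using x by auto
      have lin: "coord_change M1 i' i p 0 = 0" "coord_change M2 j' j q 0 = 0"
      proof -
        have s: "smooth_on (in_chart M1 i' (chart M1 i)) (chart M1 i' ` (chart_dom M1 i' \<inter> chart_dom M1 i))"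
          "smooth_on (in_chart M2 j' (chart M2 j)) (chart M2 j' ` (chart_dom M2 j' \<inter> chart_dom M2 j))"
          using sf3[OF sm(1)] sf3[OF sm(2)] c c' by auto
        show "coord_change M1 i' i p 0 = 0" unfolding coord_change_def dir_deriv_def
          by (rule linear_0[OF has_derivative_linear[OF smooth_diff[OF s(1)]]]) (use p in auto)
        show "coord_change M2 j' j q 0 = 0" unfolding coord_change_def dir_deriv_def
          by (rule linear_0[OF has_derivative_linear[OF smooth_diff[OF s(2)]]]) (use p in auto)
      qed
      note J = coord_change_prod[OF c'(2,3) c(2,3) p]
      have z: "riem_metric M1 i p 0 v = 0" "riem_metric M1 i p v 0 = 0" "riem_metric M2 j q 0 w = 0" "riem_metric M2 j q w 0 = 0" for v w
        using b1[of p] b2[of q] p bilinear_lzero bilinear_rzero by auto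
      note vc = spin_group_volume[OF sp(1) ev(1) L1(1)]
      show "lift ?M c c' x ** gam ?M l = clifford_vec (?n1 + ?n2) (gam ?M)
             (\<lambda>k. riem_metric ?M c x (frame ?M k c x) (coord_change ?M c' c x (frame ?M l c' x))) ** lift ?M c c' x"
      proof (cases "l < ?n1")
        case True
        have "clifford_vec ?n1 (gam M1) (\<lambda>k. riem_metric ?M c x (frame ?M k c x) (coord_change ?M c' c x (frame ?M l c' x)))
          = clifford_vec ?n1 (gam M1) (\<lambda>k. riem_metric M1 i p (frame M1 k i p) (coord_change M1 i' i p (frame M1 l i' p)))"
          by (rule cv_cong) (simp add: c c' x metric_prod frame_prod J True lin z)
        moreover have "clifford_vec ?n2 (gam M2) (\<lambda>k. riem_metric ?M c x (frame ?M (?n1 + k) c x) (coord_change ?M c' c x (frame ?M l c' x))) = 0"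
          by (simp add: c c' x metric_prod frame_prod J True lin z cv0)
        ultimately show ?thesis using L1(2)[OF True]
          by (simp add: lift_prod cv_prod kron_zero) (simp add: c c' x lift_prod gam_prod_def True kron_mult)
      next
        case False
        then have l': "l - ?n1 < ?n2" using l by linarith
        have "clifford_vec ?n1 (gam M1) (\<lambda>k. riem_metric ?M c x (frame ?M k c x) (coord_change ?M c' c x (frame ?M l c' x))) = 0"
          unfolding cv0[symmetric, of ?n1 "gam M1"]
          by (rule cv_cong) (simp add: c c' x metric_prod frame_prod J False lin z)
        moreover have "clifford_vec ?n2 (gam M2) (\<lambda>k. riem_metric ?M c x (frame ?M (?n1 + k) c x) (coord_change ?M c' c x (frame ?M l c' x)))
          = clifford_vec ?n2 (gam M2) (\<lambda>k. riem_metric M2 j q (frame M2 k j q) (coord_change M2 j' j q (frame M2 (l - ?n1) j' q)))"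
          by (simp add: c c' x metric_prod frame_prod J False lin z cv0)
        ultimately show ?thesis using L2(2)[OF l']
          by (simp add: lift_prod cv_prod kron_zero) (simp add: c c' x lift_prod gam_prod_def False kron_mult vc)
      qed
    }
    fix c'' assume "c'' \<in> idx ?M"
    then obtain i'' j'' where c'': "c'' = (i'',j'')" "i'' \<in> idx M1" "j'' \<in> idx M2" by (auto simp: dom_prod)
    fix x assume "x \<in> chart_dom ?M c \<inter> chart_dom ?M c' \<inter> chart_dom ?M c''"
    then obtain p q where x: "x = (p,q)" "p \<in> chart_dom M1 i \<inter> chart_dom M1 i' \<inter> chart_dom M1 i''" "q \<in> chart_dom M2 j \<inter> chart_dom M2 j' \<inter> chart_dom M2 j''"
      by (auto simp: dom_prod c c' c'')
    have "lift M1 i i' p ** lift M1 i' i'' p = lift M1 i i'' p" "lift M2 j j' q ** lift M2 j' j'' q = lift M2 j j'' q"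
      by (rule rs7[OF M1 c(2) c'(2) c''(2) x(2)] rs7[OF M2 c(3) c'(3) c''(3) x(3)])+
    then show "lift ?M c c' x ** lift ?M c' c'' x = lift ?M c c'' x"
      by (simp add: c c' c'' x lift_prod kron_mult)
  qed
qed

end

end

theory Submission
  imports Defs
begin

text \<open>Let \<open>\<omega>\<close> be the volume element of the first factor. It is parallel, squares to \<open>1\<close> and anticommutes
  with the vectors tangent to the first factor. In the product spinor bundle a vector \<open>X\<^sub>1\<close> tangent to the
  first factor acts on \<open>\<chi>\<^sub>1 \<otimes> \<chi>\<^sub>2\<close> as \<open>(X\<^sub>1 \<cdot> \<chi>\<^sub>1) \<otimes> \<chi>\<^sub>2\<close> and a vector \<open>X\<^sub>2\<close> tangent to the second factor as
  \<open>\<omega>\<chi>\<^sub>1 \<otimes> (X\<^sub>2 \<cdot> \<chi>\<^sub>2)\<close>. Consider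
  \<open>\<Psi> = (a + b \<omega>) \<psi>\<^sub>1 \<otimes> \<psi>\<^sub>2\<close> with real constants \<open>a\<close> and \<open>b\<close>. By the two Killing equations, with \<open>N = 2 m\<close>,
  \<open>\<nabla>\<^sub>X \<Psi> = - 1/N (X\<^sub>1 \<cdot> \<alpha> + X\<^sub>2 \<cdot> \<beta>)\<close> where \<open>\<alpha> = \<mu>\<^sub>1 (a - b \<omega>) \<psi>\<^sub>1 \<otimes> \<psi>\<^sub>2\<close> and \<open>\<beta> = \<mu>\<^sub>2 (b + a \<omega>) \<psi>\<^sub>1 \<otimes> \<psi>\<^sub>2\<close>.

  Contracting with an orthonormal frame gives \<open>D \<Psi> = \<alpha> + \<beta>\<close> and \<open>\<alpha> - \<beta>\<close> for the Dirac operator twisted by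
  the product structure. Solving for \<open>\<alpha>\<close> and \<open>\<beta>\<close> turns the equation for \<open>\<nabla>\<^sub>X \<Psi>\<close> into the desired one, except
  that \<open>D \<Psi>\<close> stands in place of a multiple of \<open>\<Psi>\<close>; this is \<open>split_killing_equation\<close>. It remains to
  choose \<open>a\<close> and \<open>b\<close> such that \<open>D \<Psi> = \<mu> \<Psi>\<close>, an eigenvector problem for a symmetric 2 by 2 matrix
  with eigenvalues \<open>\<plusminus> sqrt (\<mu>\<^sub>1\<^sup>2 + \<mu>\<^sub>2\<^sup>2)\<close>, which are non-zero; this is \<open>tensor_killing_eigenvector\<close>.

  Two ingredients are analytic. The Levi-Civita connection of the product, and with it the spin connection, is
  the sum of those of the factors (\<open>christoffel_product\<close>, \<open>connection_matrix_product\<close>). And the Killing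
  equation, which is stated for global vector fields, is needed at single tangent vectors, because a
  vector field on the product does not restrict to one vector field on a factor; this requires
  bump functions (\<open>vector_field_through\<close>, \<open>killing_spinor_at\<close>).\<close>

section \<open>Calculus of smooth maps\<close>

lemma Ck_sum:
  assumes "open S" "finite A" "\<And>a. a \<in> A \<Longrightarrow> Ck_on n (f a) S"
  shows "Ck_on n (\<lambda>x. \<Sum>a\<in>A. f a x) S"
  using assms(2,3) by (induction A) (auto intro: Ck_add Ck_const assms(1))

lemma Ck_compose:
  fixes f :: "'b::euclidean_space \<Rightarrow> 'c::real_normed_vector" and g :: "'a::euclidean_space \<Rightarrow> 'b"
  assumes "open S" "open T" "\<And>x. x \<in> T \<Longrightarrow> g x \<in> S"
  shows "Ck_on n f S \<Longrightarrow> Ck_on n g T \<Longrightarrow> Ck_on n (\<lambda>x. f (g x)) T"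
proof (induction n arbitrary: f)
  case 0
  then show ?case unfolding Ck_on.simps(1)
    by (intro continuous_on_compose2[of S f T g]) (use assms(3) in auto)
next
  case (Suc n)
  let ?f' = "\<lambda>x. frechet_derivative f (at x)" and ?g' = "\<lambda>x. frechet_derivative g (at x)"
  show ?case
  proof (rule Ck_SucI[OF assms(2)])
    show "((\<lambda>x. f (g x)) has_derivative (\<lambda>v. ?f' (g x) (?g' x v))) (at x)" if "x \<in> T" for x
      using has_derivative_compose[OF Ck_SucD(1)[OF Suc.prems(2) that] Ck_SucD(1)[OF Suc.prems(1) assms(3)[OF that]]] .
    \<comment> \<open>Expanding the inner derivative in a basis makes the outer one a sum of the fixed partial
      derivatives of \<open>f\<close> composed with \<open>g\<close>, to which the induction hypothesis applies.\<close>
    have "Ck_on n (\<lambda>x. \<Sum>b\<in>Basis. (?g' x v \<bullet> b) *\<^sub>R ?f' (g x) b) T" for v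
      by (intro Ck_sum Ck_bilinear[OF assms(2) bounded_bilinear_scaleR] Suc.IH Ck_SucD(2)[OF Suc.prems(1)]
          Ck_mono1[OF Suc.prems(2)] Ck_linear[OF assms(2) bounded_linear_inner_left] Ck_SucD(2)[OF Suc.prems(2)]
          finite_Basis assms(2))
    then show "Ck_on n (\<lambda>x. ?f' (g x) (?g' x v)) T" for v
    proof (rule Ck_cong[OF assms(2)])
      fix x assume "x \<in> T"
      interpret linear "?f' (g x)"
        by (rule has_derivative_linear[OF Ck_SucD(1)[OF Suc.prems(1) assms(3)[OF \<open>x \<in> T\<close>]]])
      have "?f' (g x) (?g' x v) = ?f' (g x) (\<Sum>b\<in>Basis. (?g' x v \<bullet> b) *\<^sub>R b)"
        by (simp only: euclidean_representation)
      then show "(\<Sum>b\<in>Basis. (?g' x v \<bullet> b) *\<^sub>R ?f' (g x) b) = ?f' (g x) (?g' x v)"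
        by (simp add: sum scaleR)
    qed
  qed
qed

lemma smooth_compose:
  fixes f :: "'b::euclidean_space \<Rightarrow> 'c::real_normed_vector" and g :: "'a::euclidean_space \<Rightarrow> 'b"
  assumes "open S" "open T" "\<And>x. x \<in> T \<Longrightarrow> g x \<in> S" "smooth_on f S" "smooth_on g T"
  shows "smooth_on (\<lambda>x. f (g x)) T"
  using Ck_compose[OF assms(1,2), of g _ f] assms(3-5) unfolding smooth_on_def by blast

lemma smooth_const: "open S \<Longrightarrow> smooth_on (\<lambda>x. c) S"
  unfolding smooth_on_def by (auto intro: Ck_const)

lemma smooth_subset: "smooth_on f S \<Longrightarrow> T \<subseteq> S \<Longrightarrow> smooth_on f T"
proof -
  have "Ck_on n f S \<Longrightarrow> T \<subseteq> S \<Longrightarrow> Ck_on n f T" for n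
    by (induction n arbitrary: f) (auto intro: continuous_on_subset)
  then show "smooth_on f S \<Longrightarrow> T \<subseteq> S \<Longrightarrow> smooth_on f T" unfolding smooth_on_def by blast
qed

lemma smooth_Un:
  assumes "open S" "open T" "smooth_on f S" "smooth_on f T"
  shows "smooth_on f (S \<union> T)"
proof -
  have "Ck_on n f S \<Longrightarrow> Ck_on n f T \<Longrightarrow> Ck_on n f (S \<union> T)" for n
  proof (induction n arbitrary: f)
    case 0 then show ?case using assms(1,2) by (simp add: continuous_on_open_Un)
  next
    case (Suc n) then show ?case by auto
  qed
  then show ?thesis using assms unfolding smooth_on_def by blast
qed

lemma smooth_frechet: "smooth_on f S \<Longrightarrow> smooth_on (\<lambda>x. frechet_derivative f (at x) v) S"
  unfolding smooth_on_def using Ck_SucD(2) by blast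

lemma smooth_ident: "open S \<Longrightarrow> smooth_on (\<lambda>x. x) S"
proof -
  assume S: "open S"
  have "Ck_on n (\<lambda>x. x) S" for n
    by (cases n) (auto intro!: Ck_SucI[OF S has_derivative_ident] Ck_const S simp del: Ck_on.simps(2))
  then show ?thesis unfolding smooth_on_def by blast
qed

section \<open>Bump functions\<close>

text \<open>The family of functions \<open>exp (- 1/x) / x^k\<close>, extended by \<open>0\<close> to the left, is closed under
  differentiation up to linear combinations. Hence one induction over the order of differentiability,
  for all \<open>k\<close> at once, shows that its members are smooth.\<close>
definition flat_exp :: "nat \<Rightarrow> real \<Rightarrow> real" where
  "flat_exp k x = (if x > 0 then exp (- inverse x) * inverse x ^ k else 0)"

text \<open>A quadratic bound is what makes the derivative at \<open>0\<close> vanish; it holds because \<open>exp (1/x)\<close>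
  dominates the term of order \<open>k + 2\<close> of its power series.\<close>
lemma flat_exp_bound: "\<bar>flat_exp k x\<bar> \<le> fact (k + 2) * x\<^sup>2"
proof (cases "x > 0")
  case True
  let ?y = "inverse x"
  have y: "?y > 0" using True by simp
  have "?y ^ (k + 2) / fact (k + 2) \<le> exp ?y"
  proof -
    have "(\<Sum>n\<in>{k+2}. ?y ^ n /\<^sub>R fact n) \<le> (\<Sum>n. ?y ^ n /\<^sub>R fact n)"
      by (rule sum_le_suminf[OF summable_exp_generic]) (use y in auto)
    then show ?thesis by (simp add: exp_def divide_inverse mult.commute)
  qed
  then have "?y ^ (k + 2) \<le> fact (k + 2) * exp ?y" by (simp only: pos_divide_le_eq[OF fact_gt_zero] mult.commute)
  then have "(?y ^ (k + 2)) * (x\<^sup>2 * exp (- ?y)) \<le> (fact (k + 2) * exp ?y) * (x\<^sup>2 * exp (- ?y))"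
    by (rule mult_right_mono) simp
  moreover have "(?y ^ (k + 2)) * (x\<^sup>2 * exp (- ?y)) = flat_exp k x"
    using True by (simp add: flat_exp_def power_add field_simps power2_eq_square)
  moreover have "(fact (k + 2) * exp ?y) * (x\<^sup>2 * exp (- ?y)) = fact (k + 2) * x\<^sup>2 * (exp ?y * exp (- ?y))"
    by (simp only: mult_ac)
  moreover have "exp ?y * exp (- ?y) = 1" by (simp flip: exp_add)
  ultimately have "flat_exp k x \<le> fact (k + 2) * x\<^sup>2" by (simp only: mult_1_right)
  moreover have "flat_exp k x \<ge> 0" using True by (simp add: flat_exp_def)
  ultimately show ?thesis by (simp only: abs_of_nonneg)
qed (simp add: flat_exp_def)

lemma flat_exp_deriv: "(flat_exp k has_real_derivative flat_exp (k + 2) x - real k * flat_exp (k + 1) x) (at x)"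
proof (cases x "0 :: real" rule: linorder_cases)
  case less
  have "(flat_exp k has_real_derivative 0) (at x)"
    by (rule DERIV_cong[OF has_field_derivative_transform_within_open[of "\<lambda>_. 0" 0 x "{..<0}"]])
      (use less in \<open>auto simp: flat_exp_def\<close>)
  then show ?thesis using less by (simp add: flat_exp_def)
next
  case equal
  have "((\<lambda>h. flat_exp k h / h) \<longlongrightarrow> 0) (at 0)"
  proof (rule Lim_null_comparison)
    show "\<forall>\<^sub>F h in at 0. norm (flat_exp k h / h) \<le> fact (k + 2) * \<bar>h\<bar>"
    proof (rule always_eventually, rule allI)
      fix h :: real
      show "norm (flat_exp k h / h) \<le> fact (k + 2) * \<bar>h\<bar>"
        using flat_exp_bound[of k h] by (cases "h = 0") (simp_all add: divide_le_eq power2_eq_square mult.assoc)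
    qed
    show "((\<lambda>h::real. fact (k + 2) * \<bar>h\<bar>) \<longlongrightarrow> 0) (at 0)"
      by (auto intro!: tendsto_eq_intros)
  qed
  then have "(flat_exp k has_real_derivative 0) (at 0)"
    by (simp add: has_field_derivative_iff flat_exp_def)
  then show ?thesis using equal by (simp add: flat_exp_def)
next
  case greater
  have inv: "(inverse has_real_derivative - (inverse x * inverse x)) (at x)"
    using DERIV_inverse[of x] greater by simp
  have p: "real k * (inverse x ^ (k - 1) * inverse x) = real k * inverse x ^ k"
    by (cases k) simp_all
  have d: "((\<lambda>y. exp (- inverse y) * inverse y ^ k) has_real_derivative
      exp (- inverse x) * (inverse x * inverse x) * inverse x ^ k
        + real k * (- (inverse x * inverse x) * inverse x ^ (k - 1)) * exp (- inverse x)) (at x)"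
    using DERIV_mult[OF DERIV_fun_exp[OF DERIV_minus[OF inv]] DERIV_power[OF inv, of k]] by simp
  have q: "real k * (- (inverse x * inverse x) * inverse x ^ (k - 1)) * exp (- inverse x)
      = - (exp (- inverse x) * (real k * inverse x ^ k) * inverse x)"
    unfolding p[symmetric] by (simp add: algebra_simps)
  from d have 1: "((\<lambda>y. exp (- inverse y) * inverse y ^ k) has_real_derivative
      exp (- inverse x) * inverse x ^ (k + 2) - real k * (exp (- inverse x) * inverse x ^ (k + 1))) (at x)"
    unfolding q by (simp add: algebra_simps)
  have "(flat_exp k has_real_derivative
      exp (- inverse x) * inverse x ^ (k + 2) - real k * (exp (- inverse x) * inverse x ^ (k + 1))) (at x)"
    by (rule has_field_derivative_transform_within_open[OF 1, of "{0<..}"])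
      (use greater in \<open>auto simp: flat_exp_def\<close>)
  then show ?thesis using greater by (simp add: flat_exp_def)
qed

lemma smooth_flat_exp: "smooth_on (flat_exp k) UNIV"
proof -
  have "Ck_on n (flat_exp k) UNIV" for n
  proof (induction n arbitrary: k)
    case 0
    show ?case unfolding Ck_on.simps(1)
      by (intro continuous_at_imp_continuous_on ballI DERIV_isCont[OF flat_exp_deriv])
  next
    case (Suc n)
    show ?case
    proof (rule Ck_SucI[OF open_UNIV])
      show "(flat_exp k has_derivative (\<lambda>v. (flat_exp (k + 2) x + (- real k) * flat_exp (k + 1) x) * v)) (at x)" for x
        using flat_exp_deriv[of k x] by (simp add: has_field_derivative_def)
      show "Ck_on n (\<lambda>x. (flat_exp (k + 2) x + (- real k) * flat_exp (k + 1) x) * v) UNIV" for v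
        by (intro Ck_bilinear[OF open_UNIV bounded_bilinear_mult] Ck_add Suc.IH Ck_const open_UNIV)
    qed
  qed
  then show ?thesis unfolding smooth_on_def by blast
qed

text \<open>The function \<open>flat_exp 0\<close> vanishes exactly on the non-positive numbers, so composing it with
  \<open>r\<^sup>2 - \<bar>y - x\<^sub>0\<bar>\<^sup>2\<close> cuts off outside of the ball.\<close>
lemma bump_function:
  fixes x0 :: "'e::euclidean_space"
  assumes "r > 0"
  obtains b :: "'e \<Rightarrow> real" where "smooth_on b UNIV" "b x0 = 1" "\<And>y. y \<notin> ball x0 r \<Longrightarrow> b y = 0"
proof
  define b where "b y = exp (inverse (r\<^sup>2)) * flat_exp 0 (r\<^sup>2 + (-1) * ((y - x0) \<bullet> (y - x0)))" for y
  have d: "smooth_on (\<lambda>y. y - x0) UNIV"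
    using smooth_add[OF open_UNIV smooth_ident[OF open_UNIV] smooth_const[OF open_UNIV, of "- x0"]] by simp
  have q: "smooth_on (\<lambda>y. r\<^sup>2 + (-1) * ((y - x0) \<bullet> (y - x0))) UNIV"
    by (intro smooth_add smooth_const open_UNIV d
        smooth_bilinear[OF open_UNIV bounded_bilinear_mult] smooth_bilinear[OF open_UNIV bounded_bilinear_inner])
  show "smooth_on b UNIV" unfolding b_def[abs_def]
    by (intro smooth_bilinear[OF open_UNIV bounded_bilinear_mult] smooth_const open_UNIV
        smooth_compose[OF open_UNIV open_UNIV UNIV_I smooth_flat_exp q])
  show "b x0 = 1" using assms by (simp add: b_def flat_exp_def flip: exp_add)
  show "b y = 0" if "y \<notin> ball x0 r" for y
  proof -
    have "r \<le> norm (y - x0)" using that by (simp add: dist_norm norm_minus_commute)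
    then have "r\<^sup>2 \<le> (y - x0) \<bullet> (y - x0)"
      using assms by (simp add: power_mono flip: power2_norm_eq_inner)
    then show ?thesis by (simp add: b_def flat_exp_def)
  qed
qed

section \<open>Vector fields with a prescribed value\<close>

context
  fixes M :: "('a::{t2_space, second_countable_topology}, 'i, 'e::euclidean_space, 'z) atlas_scheme"
  assumes M: "smooth_manifold M"
begin

lemma chart_homeo:
  assumes "i \<in> idx M"
  shows "open (chart_dom M i)" "open (chart M i ` chart_dom M i)" "inj_on (chart M i) (chart_dom M i)"
    "continuous_on (chart M i ` chart_dom M i) (inv_into (chart_dom M i) (chart M i))"
    "homeomorphism (chart_dom M i) (chart M i ` chart_dom M i) (chart M i) (inv_into (chart_dom M i) (chart M i))"
  using sf2[OF M assms] unfolding homeomorphism_def by (simp, simp, metis inj_on_inverseI, simp, simp)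

lemma in_chart_at_chart: "i \<in> idx M \<Longrightarrow> p \<in> chart_dom M i \<Longrightarrow> in_chart M i F (chart M i p) = F p"
  using chart_homeo(3) by (simp add: in_chart_def)

lemma open_chart_image:
  assumes "i \<in> idx M" "open W" 
  shows "open (chart M i ` (chart_dom M i \<inter> W))"
proof -
  have "openin (top_of_set (chart M i ` chart_dom M i)) (chart M i ` (chart_dom M i \<inter> W))"
    by (rule homeomorphism_imp_open_map[OF chart_homeo(5)[OF assms(1)]]) (use assms(2) in \<open>auto simp: openin_open\<close>)
  then show ?thesis using chart_homeo(2)[OF assms(1)] openin_open_trans by blast
qed

lemma coord_change_has_derivative:
  assumes "i \<in> idx M" "j \<in> idx M" "p \<in> chart_dom M i" "p \<in> chart_dom M j"
  shows "(in_chart M i (chart M j) has_derivative coord_change M i j p) (at (chart M i p))"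
  using smooth_diff[OF sf3[OF M assms(1,2)], of "chart M i p"] assms(3,4)
  unfolding coord_change_def dir_deriv_def[abs_def] by auto

lemma coord_change_same:
  assumes "i \<in> idx M" "p \<in> chart_dom M i"
  shows "coord_change M i i p v = v"
proof -
  have "((\<lambda>x. x) has_derivative coord_change M i i p) (at (chart M i p))"
    by (rule has_derivative_transform_within_open[OF coord_change_has_derivative[OF assms(1,1,2,2)] chart_homeo(2)[OF assms(1)]])
      (use assms in_chart_at_chart in auto)
  then show ?thesis using has_derivative_unique[OF has_derivative_ident] by metis
qed

text \<open>The cocycle rule is the chain rule for the chart transitions.\<close>
lemma coord_change_trans:
  assumes i: "i \<in> idx M" "j \<in> idx M" "k \<in> idx M" and p: "p \<in> chart_dom M i" "p \<in> chart_dom M j" "p \<in> chart_dom M k"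
  shows "coord_change M j k p (coord_change M i j p v) = coord_change M i k p v"
proof -
  have "((\<lambda>x. in_chart M j (chart M k) (in_chart M i (chart M j) x)) has_derivative
      (\<lambda>v. coord_change M j k p (coord_change M i j p v))) (at (chart M i p))"
    by (rule has_derivative_compose[OF coord_change_has_derivative[OF i(1,2) p(1,2)]])
      (use coord_change_has_derivative[OF i(2,3) p(2,3)] in \<open>simp add: in_chart_at_chart i p\<close>)
  then have "(in_chart M i (chart M k) has_derivative (\<lambda>v. coord_change M j k p (coord_change M i j p v))) (at (chart M i p))"
    by (rule has_derivative_transform_within_open[OF _ open_chart_image[OF i(1) chart_homeo(1)[OF i(2)]]])
      (use i p in \<open>auto simp: in_chart_at_chart\<close>)
  then show ?thesis using has_derivative_unique[OF coord_change_has_derivative[OF i(1,3) p(1,3)]] by metis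
qed

text \<open>A Killing spinor is only known to satisfy its equation for globally defined vector fields. To use
  the equation at a single tangent vector, the vector has to be extended to all of the manifold: the
  constant field in a chart is multiplied by a bump function whose support is compact in the chart.
  Since the space is Hausdorff, the support is closed in the manifold, so that extension by \<open>0\<close> is
  smooth.\<close>
lemma vector_field_through:
  assumes i: "i \<in> idx M" and p: "p \<in> chart_dom M i"
  obtains X where "vector_field M X" "X i p = v"
proof -
  let ?x0 = "chart M i p"
  obtain r where r: "r > 0" "cball ?x0 r \<subseteq> chart M i ` chart_dom M i"
    using chart_homeo(2)[OF i] p open_contains_cball by blast
  obtain b :: "'e \<Rightarrow> real" where b: "smooth_on b UNIV" "b ?x0 = 1" "\<And>y. y \<notin> ball ?x0 r \<Longrightarrow> b y = 0"
    using bump_function[OF r(1)] by blast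
  define X where "X j p' = (if p' \<in> chart_dom M i then b (chart M i p') *\<^sub>R coord_change M i j p' v else 0)" for j p'
  define K where "K = inv_into (chart_dom M i) (chart M i) ` cball ?x0 r"
  have "compact K" unfolding K_def
    by (intro compact_continuous_image continuous_on_subset[OF chart_homeo(4)[OF i] r(2)] compact_cball)
  then have K: "open (- K)" by (auto dest: compact_imp_closed)
  have Ki: "K \<subseteq> chart_dom M i" using r(2) unfolding K_def by (auto intro: inv_into_into)
  have X0: "X j p' = 0" if "p' \<notin> K" for j p'
  proof (cases "p' \<in> chart_dom M i")
    case True
    have "chart M i p' \<notin> ball ?x0 r"
    proof
      assume "chart M i p' \<in> ball ?x0 r"
      then have "chart M i p' \<in> cball ?x0 r" by simp
      then have "inv_into (chart_dom M i) (chart M i) (chart M i p') \<in> K" unfolding K_def by (rule imageI)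
      then show False using that True chart_homeo(3)[OF i] by simp
    qed
    then show ?thesis by (simp add: X_def b)
  qed (simp add: X_def)
  have "vector_field M X" unfolding vector_field_def
  proof (intro conjI ballI)
    fix j assume j: "j \<in> idx M"
    \<comment> \<open>The chart domain is covered by the overlap with the chart \<open>i\<close>, where the explicit formula is
      smooth, and by the complement of the support, where the field is zero.\<close>
    let ?S = "chart M j ` (chart_dom M j \<inter> chart_dom M i)" and ?T = "chart M j ` (chart_dom M j \<inter> - K)"
    let ?I = "chart M i ` (chart_dom M i \<inter> chart_dom M j)"
    have o: "open ?S" "open ?T" "open ?I" by (intro open_chart_image chart_homeo(1) i j K)+
    have "smooth_on (\<lambda>x. b x *\<^sub>R frechet_derivative (in_chart M i (chart M j)) (at x) v) ?I"
      by (intro smooth_bilinear[OF o(3) bounded_bilinear_scaleR] smooth_subset[OF b(1)] smooth_frechet sf3[OF M] i j subset_UNIV)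
    then have "smooth_on (\<lambda>y. b (in_chart M j (chart M i) y) *\<^sub>R
        frechet_derivative (in_chart M i (chart M j)) (at (in_chart M j (chart M i) y)) v) ?S"
      by (rule smooth_compose[OF o(3,1), rotated]) (use sf3[OF M j i] in \<open>auto simp: in_chart_at_chart i j\<close>)
    then have 1: "smooth_on (in_chart M j (X j)) ?S"
      by (rule smooth_cong[OF o(1)]) (auto simp: in_chart_at_chart i j X_def coord_change_def dir_deriv_def)
    have 2: "smooth_on (in_chart M j (X j)) ?T"
      by (rule smooth_cong[OF o(2) smooth_const[OF o(2), of 0]]) (auto simp: in_chart_at_chart j X0)
    have "chart M j ` chart_dom M j = ?S \<union> ?T" using Ki by auto
    then show "smooth_on (in_chart M j (X j)) (chart M j ` chart_dom M j)"
      using smooth_Un[OF o(1,2) 1 2] by simp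
    fix k p' assume k: "k \<in> idx M" "p' \<in> chart_dom M j \<inter> chart_dom M k"
    interpret linear "coord_change M j k p'"
      by (rule has_derivative_linear[OF coord_change_has_derivative]) (use j k in auto)
    show "X k p' = coord_change M j k p' (X j p')"
      using coord_change_trans[OF i j k(1), of p' v] k(2) by (simp add: X_def scaleR zero)
  qed
  moreover have "X i p = v" by (simp add: X_def p b coord_change_same[OF i p])
  ultimately show ?thesis by (rule that)
qed

end

section \<open>Tensor products of spinors\<close>

interpretation mv: bounded_bilinear "(*v) :: complex^'n^'m \<Rightarrow> complex^'n \<Rightarrow> complex^'m"
  by (subst bilinear_conv_bounded_bilinear[symmetric])
    (auto simp: bilinear_def linear_iff vec_eq_iff matrix_vector_mult_def sum.distrib algebra_simps scaleR_sum_right)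

definition tensor :: "complex^'s \<Rightarrow> complex^'t \<Rightarrow> complex^('s \<times> 't)" where
  "tensor u w = (\<chi> r. u $ fst r * w $ snd r)"

interpretation tensor: bounded_bilinear "tensor :: complex^'s \<Rightarrow> complex^'t \<Rightarrow> complex^('s \<times> 't)"
  by (subst bilinear_conv_bounded_bilinear[symmetric])
    (auto simp: bilinear_def linear_iff vec_eq_iff tensor_def algebra_simps)

lemma kron_tensor: "kron A B *v tensor u w = tensor (A *v u) (B *v w)"
  by (simp add: vec_eq_iff kron_def tensor_def matrix_vector_mult_def UNIV_Times_UNIV[symmetric]
      sum.cartesian_product' sum_product ac_simps del: UNIV_Times_UNIV)

lemma tensor_eq_0: "tensor u w = 0 \<longleftrightarrow> u = 0 \<or> w = 0"
  by (auto simp: vec_eq_iff tensor_def)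

section \<open>The spin derivative at a tangent vector\<close>

text \<open>The zeroth-order part of the spin derivative. As \<open>spin_deriv M X \<psi>\<close> at a point depends on the
  vector field \<open>X\<close> only through its value there, all further computations are done with single
  tangent vectors; the constant field in \<open>cov_deriv\<close> merely carries the vector \<open>v\<close>.\<close>
definition connection_matrix ::
    "('a, 'i, 'e::euclidean_space, 's::finite, 'z) spin_atlas_scheme \<Rightarrow> 'i \<Rightarrow> 'a \<Rightarrow> 'e \<Rightarrow> complex^'s^'s" where
  "connection_matrix M i p v = (1 / 2) *\<^sub>R (\<Sum>l<DIM('e). \<Sum>k<l.
     riem_metric M i p (cov_deriv M (\<lambda>_ _. v) (frame M k) i p) (frame M l i p) *\<^sub>R (gam M k ** gam M l))"

definition spin_deriv_at ::
    "('a, 'i, 'e::euclidean_space, 's::finite, 'z) spin_atlas_scheme \<Rightarrow> ('i \<Rightarrow> 'a \<Rightarrow> complex^'s) \<Rightarrow> 'i \<Rightarrow> 'a \<Rightarrow> 'e \<Rightarrow> complex^'s" where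
  "spin_deriv_at M \<psi> i p v = dir_deriv M i (\<psi> i) p v + connection_matrix M i p v *v \<psi> i p"

lemma spin_deriv_eq: "spin_deriv M X \<psi> i p = spin_deriv_at M \<psi> i p (X i p)"
  by (simp add: spin_deriv_def spin_deriv_at_def connection_matrix_def cov_deriv_def
      mv.scaleR_left mv.sum_left matrix_vector_mul_assoc)

definition clifford_matrix ::
    "('a, 'i, 'e::euclidean_space, 's::finite, 'z) spin_atlas_scheme \<Rightarrow> 'i \<Rightarrow> 'a \<Rightarrow> 'e \<Rightarrow> complex^'s^'s" where
  "clifford_matrix M i p v = clifford_vec DIM('e) (gam M) (\<lambda>k. riem_metric M i p v (frame M k i p))"

lemma clifford_mult_eq: "clifford_mult M X \<psi> i p = clifford_matrix M i p (X i p) *v \<psi> i p"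
  by (simp add: clifford_mult_def clifford_matrix_def)

text \<open>Both sides of the Killing equation depend on the vector field only through its value at the point,
  and every value is attained by a global vector field.\<close>
lemma killing_spinor_at:
  fixes M :: "('a::{t2_space, second_countable_topology}, 'i, 'e::euclidean_space, 's::finite, 'z) spin_atlas_scheme"
  assumes M: "smooth_manifold M" and \<psi>: "killing_spinor M \<mu> \<psi>" and i: "i \<in> idx M" and p: "p \<in> chart_dom M i"
  shows "spin_deriv_at M \<psi> i p v = - (\<mu> / DIM('e)) *\<^sub>R (clifford_matrix M i p v *v \<psi> i p)"
proof -
  obtain X where X: "vector_field M X" "X i p = v" using vector_field_through[OF M i p] by blast
  have "same_field M (spin_deriv M X \<psi>) (\<lambda>i p. - (\<mu> / real DIM('e)) *\<^sub>R clifford_mult M X \<psi> i p)"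
    using \<psi> X(1) unfolding killing_spinor_def by blast
  then have "spin_deriv M X \<psi> i p = - (\<mu> / real DIM('e)) *\<^sub>R clifford_mult M X \<psi> i p"
    using i p unfolding same_field_def by blast
  then show ?thesis by (simp add: spin_deriv_eq clifford_mult_eq X(2))
qed

lemma dir_deriv_has_derivative:
  assumes "smooth_on (in_chart M i f) (chart M i ` chart_dom M i)" "p \<in> chart_dom M i"
  shows "(in_chart M i f has_derivative dir_deriv M i f p) (at (chart M i p))"
  using smooth_diff[OF assms(1) imageI[OF assms(2)]] by (simp add: dir_deriv_def[abs_def])

lemma dir_deriv_eqI: "(in_chart M i f has_derivative f') (at (chart M i p)) \<Longrightarrow> dir_deriv M i f p v = f' v"
  by (metis dir_deriv_def frechet_derivative_at)

lemma levi_civita_christoffel: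
  assumes "riemannian_manifold M" "i \<in> idx M" "p \<in> chart_dom M i"
  shows "levi_civita_at M i p (christoffel M i p)"
  unfolding christoffel_def by (rule theI'[OF levi_civita_ex1[OF assms]])

lemma clifford_matrix_linear:
  assumes "riemannian_manifold M" "i \<in> idx M" "p \<in> chart_dom M i"
  shows "linear (clifford_matrix M i p)"
proof -
  have b: "bilinear (riem_metric M i p)" using rm2[OF assms] by simp
  show ?thesis unfolding clifford_matrix_def clifford_vec_def
    by (rule linearI) (simp_all add: bilinear_ladd[OF b] bilinear_lmul[OF b] sum.distrib scaleR_add_left scaleR_right.sum)
qed

lemma clifford_matrix_frame:
  fixes M :: "('a::{t2_space, second_countable_topology}, 'i, 'e::euclidean_space, 's::finite, 'z) spin_atlas_scheme"
  assumes M: "riemannian_spin_manifold M" and i: "i \<in> idx M" and p: "p \<in> chart_dom M i" and k: "k < DIM('e)"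
  shows "clifford_matrix M i p (frame M k i p) = gam M k"
proof -
  have "clifford_matrix M i p (frame M k i p) = (\<Sum>l<DIM('e). (if k = l then 1 else 0) *\<^sub>R gam M l)"
    unfolding clifford_matrix_def clifford_vec_def by (rule sum.cong) (use rs4[OF M i p k] in auto)
  also have "\<dots> = (\<Sum>l<DIM('e). if k = l then gam M l else 0)" by (rule sum.cong) auto
  finally show ?thesis using k by simp
qed

section \<open>Action of the volume element on spinor fields\<close>

text \<open>The elements \<open>a + b \<omega>\<close> of the algebra generated by the volume element \<open>\<omega>\<close>. In even dimension they commute
  with the even part of the Clifford algebra, therefore with the lifts of the frame changes and with the
  connection, and act on spinor fields as parallel endomorphisms. Moving them past a vector changes
  the sign of \<open>b\<close>.\<close>
definition volume_scalar :: "nat \<Rightarrow> (nat \<Rightarrow> complex^'s^'s) \<Rightarrow> real \<Rightarrow> real \<Rightarrow> complex^'s^'s" where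
  "volume_scalar n \<gamma> a b = a *\<^sub>R mat 1 + b *\<^sub>R volume_element n \<gamma>"

lemma volume_scalar_arith:
  "volume_scalar n \<gamma> a b + volume_scalar n \<gamma> c d = volume_scalar n \<gamma> (a + c) (b + d)"
  "r *\<^sub>R volume_scalar n \<gamma> a b = volume_scalar n \<gamma> (r * a) (r * b)"
  "volume_element n \<gamma> = volume_scalar n \<gamma> 0 1"
  by (simp_all add: volume_scalar_def algebra_simps)

lemma volume_scalar_mult:
  assumes "spinor_module n \<gamma>" "even n"
  shows "volume_scalar n \<gamma> a b ** volume_scalar n \<gamma> c d = volume_scalar n \<gamma> (a * c + b * d) (a * d + b * c)"
  by (simp add: volume_scalar_def matrix_add_ldistrib mat_radd mat_scaleR_simps volume_sq[OF assms] algebra_simps)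

lemma volume_scalar_gam:
  assumes "spinor_module n \<gamma>" "even n" "k < n"
  shows "volume_scalar n \<gamma> a b ** \<gamma> k = \<gamma> k ** volume_scalar n \<gamma> a (- b)"
  by (simp add: volume_scalar_def matrix_add_ldistrib mat_radd mat_scaleR_simps volume_anti[OF assms] del: scaleR_minus_left) simp

lemma volume_scalar_clifford_matrix:
  fixes M :: "('a::{t2_space, second_countable_topology}, 'i, 'e::euclidean_space, 's::finite, 'z) spin_atlas_scheme"
  assumes "spinor_module DIM('e) (gam M)" "even DIM('e)"
  shows "volume_scalar DIM('e) (gam M) a b ** clifford_matrix M i p v = clifford_matrix M i p v ** volume_scalar DIM('e) (gam M) a (- b)"
  unfolding clifford_matrix_def clifford_vec_def
  by (simp add: mat_scaleR_simps volume_scalar_gam[OF assms])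

lemma volume_scalar_spin_group:
  assumes "spinor_module n \<gamma>" "even n" "s \<in> spin_group n \<gamma>"
  shows "s ** volume_scalar n \<gamma> a b = volume_scalar n \<gamma> a b ** s"
  by (simp add: volume_scalar_def matrix_add_ldistrib mat_radd mat_scaleR_simps spin_group_volume[OF assms])

text \<open>The connection is a combination of products of two vectors, so the sign of \<open>b\<close> changes twice.\<close>
lemma volume_scalar_connection_matrix:
  fixes M :: "('a::{t2_space, second_countable_topology}, 'i, 'e::euclidean_space, 's::finite, 'z) spin_atlas_scheme"
  assumes "spinor_module DIM('e) (gam M)" "even DIM('e)"
  shows "volume_scalar DIM('e) (gam M) a b ** connection_matrix M i p v = connection_matrix M i p v ** volume_scalar DIM('e) (gam M) a b"
proof -
  let ?W = "\<lambda>b. volume_scalar DIM('e) (gam M) a b"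
  have "?W b ** (gam M k ** gam M l) = (gam M k ** gam M l) ** ?W b" if "l < DIM('e)" "k < l" for k l
  proof -
    have kl: "k < DIM('e)" "l < DIM('e)" using that by auto
    have "?W b ** (gam M k ** gam M l) = gam M k ** (?W (- b) ** gam M l)"
      by (simp only: matrix_mul_assoc volume_scalar_gam[OF assms kl(1)])
    also have "?W (- b) ** gam M l = gam M l ** ?W b"
      using volume_scalar_gam[OF assms kl(2), of a "- b"] by simp
    also have "gam M k ** (gam M l ** ?W b) = (gam M k ** gam M l) ** ?W b" by (rule matrix_mul_assoc)
    finally show ?thesis .
  qed
  then show ?thesis unfolding connection_matrix_def
    by (simp add: mat_scaleR_simps)
qed

lemma spin_deriv_at_volume_scalar:
  fixes M :: "('a::{t2_space, second_countable_topology}, 'i, 'e::euclidean_space, 's::finite, 'z) spin_atlas_scheme"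
  assumes M: "riemannian_spin_manifold M" "even DIM('e)" and \<psi>: "spinor_field M \<psi>" and i: "i \<in> idx M" and p: "p \<in> chart_dom M i"
  shows "spin_deriv_at M (\<lambda>i p. volume_scalar DIM('e) (gam M) a b *v \<psi> i p) i p v
    = volume_scalar DIM('e) (gam M) a b *v spin_deriv_at M \<psi> i p v"
proof -
  let ?W = "volume_scalar DIM('e) (gam M) a b"
  have "smooth_on (in_chart M i (\<psi> i)) (chart M i ` chart_dom M i)"
    using \<psi> i unfolding spinor_field_def by blast
  from dir_deriv_has_derivative[OF this p]
  have "(in_chart M i (\<lambda>p. ?W *v \<psi> i p) has_derivative (\<lambda>v. ?W *v dir_deriv M i (\<psi> i) p v)) (at (chart M i p))"
    using bounded_linear.has_derivative[OF mv.bounded_linear_right] by (simp add: in_chart_def comp_def)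
  then show ?thesis
    using volume_scalar_connection_matrix[OF rs2[OF M(1)] M(2), of a b i p v]
    by (simp add: spin_deriv_at_def dir_deriv_eqI mv.add_right matrix_vector_mul_assoc)
qed

lemma spinor_field_volume_scalar:
  fixes M :: "('a::{t2_space, second_countable_topology}, 'i, 'e::euclidean_space, 's::finite, 'z) spin_atlas_scheme"
  assumes M: "riemannian_spin_manifold M" "even DIM('e)" and \<psi>: "spinor_field M \<psi>"
  shows "spinor_field M (\<lambda>i p. volume_scalar DIM('e) (gam M) a b *v \<psi> i p)"
  unfolding spinor_field_def
proof (intro conjI ballI)
  fix i assume i: "i \<in> idx M"
  have o: "open (chart M i ` chart_dom M i)" by (rule chart_homeo(2)[OF rm1[OF rs1[OF M(1)]] i])
  have "smooth_on (in_chart M i (\<psi> i)) (chart M i ` chart_dom M i)"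
    using \<psi> i unfolding spinor_field_def by blast
  from smooth_linear[OF o mv.bounded_linear_right this, of "volume_scalar DIM('e) (gam M) a b"]
  show "smooth_on (in_chart M i (\<lambda>p. volume_scalar DIM('e) (gam M) a b *v \<psi> i p)) (chart M i ` chart_dom M i)"
    by (simp add: in_chart_def comp_def)
  fix j p assume j: "j \<in> idx M" "p \<in> chart_dom M i \<inter> chart_dom M j"
  have "lift M i j p \<in> spin_group DIM('e) (gam M)" using rs6[OF M(1) i j] by blast
  from volume_scalar_spin_group[OF rs2[OF M(1)] M(2) this] have
    "volume_scalar DIM('e) (gam M) a b *v (lift M i j p *v \<psi> j p) = lift M i j p *v (volume_scalar DIM('e) (gam M) a b *v \<psi> j p)"
    by (simp add: matrix_vector_mul_assoc)
  moreover have "\<psi> i p = lift M i j p *v \<psi> j p" using \<psi> i j unfolding spinor_field_def by blast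
  ultimately show "volume_scalar DIM('e) (gam M) a b *v \<psi> i p = lift M i j p *v (volume_scalar DIM('e) (gam M) a b *v \<psi> j p)"
    by (simp only:)
qed

section \<open>The spin derivative of a Riemannian product\<close>

context
  fixes M1 :: "('a::{t2_space, second_countable_topology}, 'i, 'e::euclidean_space, 's::finite) spin_atlas"
    and M2 :: "('b::{t2_space, second_countable_topology}, 'j, 'f::euclidean_space, 't::finite) spin_atlas"
  assumes M1: "riemannian_spin_manifold M1" and M2: "riemannian_spin_manifold M2"
    and ev: "even DIM('e)" "even DIM('f)"
begin

private abbreviation (input) P where "P \<equiv> spin_product M1 M2"

private lemmas P_idx_dom = dom_prod[OF M1 M2 ev]
private lemmas P_metric = metric_prod[OF M1 M2 ev]
private lemmas P_frame = frame_prod[OF M1 M2 ev]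
private lemmas P_lift = lift_prod(1)[OF M1 M2 ev]
private lemmas P_gam = lift_prod(2)[OF M1 M2 ev]
private lemmas P_in_chart = in_chart_prod[OF M1 M2 ev]
private lemmas P_smooth = smooth_prodI[OF M1 M2 ev]
private lemmas smooth_factors = sm[OF M1 M2 ev]
private lemmas P_riemannian = riemannian_prod[OF M1 M2 ev]
private lemmas P_spin = riemannian_spin_manifold_spin_product[OF M1 M2 ev]

private lemma P_chart: "chart P (i, j) (p, q) = (chart M1 i p, chart M2 j q)"
  by (simp add: spin_product_def)

context
  fixes i j p q
  assumes i: "i \<in> idx M1" and j: "j \<in> idx M2" and p: "p \<in> chart_dom M1 i" and q: "q \<in> chart_dom M2 j"
begin

private lemma P_point: "(i, j) \<in> idx P" "(p, q) \<in> chart_dom P (i, j)"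
  using i j p q by (simp_all add: P_idx_dom)

lemma has_derivative_product:
  assumes "((\<lambda>z. F (fst z) (snd z)) has_derivative F') (at (chart M1 i p, chart M2 j q))"
    and "\<And>x y. x \<in> chart M1 i ` chart_dom M1 i \<Longrightarrow> y \<in> chart M2 j ` chart_dom M2 j \<Longrightarrow>
      F x y = G (inv_into (chart_dom M1 i) (chart M1 i) x, inv_into (chart_dom M2 j) (chart M2 j) y)"
  shows "(in_chart P (i, j) G has_derivative F') (at (chart P (i, j) (p, q)))"
  unfolding P_chart
proof (rule has_derivative_transform_within_open[OF assms(1)])
  show "open (chart M1 i ` chart_dom M1 i \<times> chart M2 j ` chart_dom M2 j)"
    by (intro open_Times chart_homeo(2) smooth_factors i j)
  show "(chart M1 i p, chart M2 j q) \<in> chart M1 i ` chart_dom M1 i \<times> chart M2 j ` chart_dom M2 j"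
    using p q by blast
  fix z assume "z \<in> chart M1 i ` chart_dom M1 i \<times> chart M2 j ` chart_dom M2 j"
  then obtain x y where z: "z = (x, y)" "x \<in> chart M1 i ` chart_dom M1 i" "y \<in> chart M2 j ` chart_dom M2 j" by blast
  show "F (fst z) (snd z) = in_chart P (i, j) G z"
    using assms(2)[OF z(2,3)] P_in_chart[OF i j z(2,3), of G] z(1) by simp
qed

lemma has_derivative_fst_factor:
  assumes "smooth_on (in_chart M1 i f) (chart M1 i ` chart_dom M1 i)"
  shows "(in_chart P (i, j) (\<lambda>x. f (fst x)) has_derivative (\<lambda>v. dir_deriv M1 i f p (fst v))) (at (chart P (i, j) (p, q)))"
  by (rule has_derivative_product[OF has_derivative_compose[OF has_derivative_fst[OF has_derivative_ident]]])
    (use dir_deriv_has_derivative[OF assms p] in \<open>auto simp: in_chart_def comp_def\<close>)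

lemma has_derivative_snd_factor:
  assumes "smooth_on (in_chart M2 j f) (chart M2 j ` chart_dom M2 j)"
  shows "(in_chart P (i, j) (\<lambda>x. f (snd x)) has_derivative (\<lambda>v. dir_deriv M2 j f q (snd v))) (at (chart P (i, j) (p, q)))"
  by (rule has_derivative_product[OF has_derivative_compose[OF has_derivative_snd[OF has_derivative_ident]]])
    (use dir_deriv_has_derivative[OF assms q] in \<open>auto simp: in_chart_def comp_def\<close>)

text \<open>The product of the two Levi-Civita connections is symmetric and metric, hence it is the
  Levi-Civita connection of the product.\<close>
lemma christoffel_product:
  "christoffel P (i, j) (p, q) v w = (christoffel M1 i p (fst v) (fst w), christoffel M2 j q (snd v) (snd w))"
proof -
  let ?G1 = "christoffel M1 i p" and ?G2 = "christoffel M2 j q"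
  let ?G = "\<lambda>v w. (?G1 (fst v) (fst w), ?G2 (snd v) (snd w))"
  note 1 = levi_civita_christoffel[OF smooth_factors(3) i p] and 2 = levi_civita_christoffel[OF smooth_factors(4) j q]
  have b: "bilinear ?G1" "bilinear ?G2" using 1 2 unfolding levi_civita_at_def by blast+
  have "levi_civita_at P (i, j) (p, q) ?G" unfolding levi_civita_at_def
  proof (intro conjI allI)
    show "bilinear ?G" using b unfolding bilinear_def linear_iff by auto
    show "?G v w = ?G w v" for v w using 1 2 unfolding levi_civita_at_def by auto
    fix u v w
    have m: "smooth_on (in_chart M1 i (\<lambda>p. riem_metric M1 i p (fst v) (fst w))) (chart M1 i ` chart_dom M1 i)"
      "smooth_on (in_chart M2 j (\<lambda>q. riem_metric M2 j q (snd v) (snd w))) (chart M2 j ` chart_dom M2 j)"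
      by (rule rm3[OF smooth_factors(3) i] rm3[OF smooth_factors(4) j])+
    have "(in_chart P (i, j) (\<lambda>x. riem_metric P (i, j) x v w) has_derivative
        (\<lambda>u. dir_deriv M1 i (\<lambda>p. riem_metric M1 i p (fst v) (fst w)) p (fst u)
           + dir_deriv M2 j (\<lambda>q. riem_metric M2 j q (snd v) (snd w)) q (snd u))) (at (chart P (i, j) (p, q)))"
      using has_derivative_add[OF has_derivative_fst_factor[OF m(1)] has_derivative_snd_factor[OF m(2)]]
      by (simp add: in_chart_def comp_def case_prod_unfold spin_product_def)
    from dir_deriv_eqI[OF this, of u]
    show "dir_deriv P (i, j) (\<lambda>x. riem_metric P (i, j) x v w) (p, q) u
      = riem_metric P (i, j) (p, q) (?G u v) w + riem_metric P (i, j) (p, q) v (?G u w)"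
      using 1 2 by (simp add: P_metric levi_civita_at_def)
  qed
  moreover have "levi_civita_at P (i, j) (p, q) (christoffel P (i, j) (p, q))"
    by (rule levi_civita_christoffel[OF P_riemannian P_point])
  ultimately have "christoffel P (i, j) (p, q) = ?G"
    using levi_civita_ex1[OF P_riemannian P_point] by blast
  then show ?thesis by simp
qed

lemma cov_deriv_frame_product:
  "k < DIM('e) \<Longrightarrow> cov_deriv P (\<lambda>_ _. v) (frame P k) (i, j) (p, q) = (cov_deriv M1 (\<lambda>_ _. fst v) (frame M1 k) i p, 0)"
  "k < DIM('f) \<Longrightarrow> cov_deriv P (\<lambda>_ _. v) (frame P (DIM('e) + k)) (i, j) (p, q) = (0, cov_deriv M2 (\<lambda>_ _. snd v) (frame M2 k) j q)"
proof -
  have z: "christoffel M1 i p u 0 = 0" "christoffel M2 j q w 0 = 0" for u w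
    using levi_civita_christoffel[OF smooth_factors(3) i p] levi_civita_christoffel[OF smooth_factors(4) j q]
    unfolding levi_civita_at_def by (blast intro: bilinear_rzero)+
  {
    assume k: "k < DIM('e)"
    have "(in_chart P (i, j) (frame P k (i, j)) has_derivative
        (\<lambda>v. (dir_deriv M1 i (frame M1 k i) p (fst v), 0))) (at (chart P (i, j) (p, q)))"
      using bounded_linear.has_derivative[OF bl_Pair(1) has_derivative_fst_factor[OF rs3[OF M1 i k]]] k
      by (simp add: in_chart_def comp_def spin_product_def case_prod_unfold)
    from dir_deriv_eqI[OF this, of v]
    show "cov_deriv P (\<lambda>_ _. v) (frame P k) (i, j) (p, q) = (cov_deriv M1 (\<lambda>_ _. fst v) (frame M1 k) i p, 0)"
      using k by (simp add: cov_deriv_def christoffel_product P_frame z)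
  }
  {
    assume k: "k < DIM('f)"
    have "(in_chart P (i, j) (frame P (DIM('e) + k) (i, j)) has_derivative
        (\<lambda>v. (0, dir_deriv M2 j (frame M2 k j) q (snd v)))) (at (chart P (i, j) (p, q)))"
      using bounded_linear.has_derivative[OF bl_Pair(2) has_derivative_snd_factor[OF rs3[OF M2 j k]]]
      by (simp add: in_chart_def comp_def spin_product_def case_prod_unfold)
    from dir_deriv_eqI[OF this, of v]
    show "cov_deriv P (\<lambda>_ _. v) (frame P (DIM('e) + k)) (i, j) (p, q) = (0, cov_deriv M2 (\<lambda>_ _. snd v) (frame M2 k) j q)"
      by (simp add: cov_deriv_def christoffel_product P_frame z)
  }
qed

lemma metric_zero:
  "riem_metric M1 i p 0 v = 0" "riem_metric M1 i p v 0 = 0" "riem_metric M2 j q 0 w = 0" "riem_metric M2 j q w 0 = 0"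
  using rm2[OF smooth_factors(3) i p] rm2[OF smooth_factors(4) j q]
  by (auto simp: bilinear_lzero bilinear_rzero)

text \<open>The mixed coefficients \<open>g(\<nabla> E\<^sub>k, E\<^sub>l)\<close> vanish because the covariant derivative keeps the frame
  vectors tangent to their factor, and in the products of two vectors tangent to the second factor
  the two volume elements cancel.\<close>
lemma connection_matrix_product:
  "connection_matrix P (i, j) (p, q) v
    = kron (connection_matrix M1 i p (fst v)) (mat 1) + kron (mat 1) (connection_matrix M2 j q (snd v))"
proof -
  let ?n = "DIM('e)" and ?m = "DIM('f)"
  let ?G = "gam_prod ?n (gam M1) (gam M2)"
  define g where "g k l = riem_metric P (i, j) (p, q) (cov_deriv P (\<lambda>_ _. v) (frame P k) (i, j) (p, q)) (frame P l (i, j) (p, q))" for k l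
  define g1 where "g1 k l = riem_metric M1 i p (cov_deriv M1 (\<lambda>_ _. fst v) (frame M1 k) i p) (frame M1 l i p)" for k l
  define g2 where "g2 k l = riem_metric M2 j q (cov_deriv M2 (\<lambda>_ _. snd v) (frame M2 k) j q) (frame M2 l j q)" for k l
  have g: "k < ?n \<Longrightarrow> l < ?n \<Longrightarrow> g k l = g1 k l" "k < ?n \<Longrightarrow> g k (?n + l') = 0"
    "k' < ?m \<Longrightarrow> g (?n + k') (?n + l') = g2 k' l'" for k l k' l'
    by (simp_all add: g_def g1_def g2_def cov_deriv_frame_product P_frame P_metric metric_zero)
  have A: "(\<Sum>k<l. g k l *\<^sub>R (?G k ** ?G l)) = kron (\<Sum>k<l. g1 k l *\<^sub>R (gam M1 k ** gam M1 l)) (mat 1)"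
    if "l < ?n" for l
    unfolding kron_sum using that by (intro sum.cong) (auto simp: g gam_prod_def kron_mult kron_scaleR)
  have B: "(\<Sum>k<?n + l. g k (?n + l) *\<^sub>R (?G k ** ?G (?n + l))) = kron (mat 1) (\<Sum>k<l. g2 k l *\<^sub>R (gam M2 k ** gam M2 l))"
    if "l < ?m" for l
    unfolding kron_sum sum_split using that
    by (simp add: g gam_prod_def kron_mult kron_scaleR volume_sq[OF rs2[OF M1] ev(1)])
  have "connection_matrix P (i, j) (p, q) v = (1 / 2) *\<^sub>R (\<Sum>l<?n + ?m. \<Sum>k<l. g k l *\<^sub>R (?G k ** ?G l))"
    by (simp add: connection_matrix_def g_def P_gam)
  also have "\<dots> = (1 / 2) *\<^sub>R (kron (\<Sum>l<?n. \<Sum>k<l. g1 k l *\<^sub>R (gam M1 k ** gam M1 l)) (mat 1)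
      + kron (mat 1) (\<Sum>l<?m. \<Sum>k<l. g2 k l *\<^sub>R (gam M2 k ** gam M2 l)))"
    unfolding sum_split[of _ ?n ?m] kron_sum(1)[of _ "{..<?n}"] kron_sum(2)[of _ _ "{..<?m}"]
    by (simp add: A B)
  finally show ?thesis
    by (simp add: connection_matrix_def g1_def g2_def kron_scaleR scaleR_add_right)
qed

lemma clifford_matrix_product:
  "clifford_matrix P (i, j) (p, q) v = kron (clifford_matrix M1 i p (fst v)) (mat 1)
    + kron (volume_element DIM('e) (gam M1)) (clifford_matrix M2 j q (snd v))"
proof -
  have "clifford_vec DIM('e) (gam M1) (\<lambda>k. riem_metric P (i, j) (p, q) v (frame P k (i, j) (p, q))) = clifford_matrix M1 i p (fst v)"
    unfolding clifford_matrix_def by (rule cv_cong) (simp add: P_metric P_frame metric_zero)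
  moreover have "clifford_vec DIM('f) (gam M2) (\<lambda>k. riem_metric P (i, j) (p, q) v (frame P (DIM('e) + k) (i, j) (p, q))) = clifford_matrix M2 j q (snd v)"
    unfolding clifford_matrix_def by (rule cv_cong) (simp add: P_metric P_frame metric_zero)
  ultimately show ?thesis by (simp add: clifford_matrix_def[of P] P_gam cv_prod)
qed

text \<open>The Leibniz rule: the connection of the product acts on one tensor factor at a time, as does the
  derivative of a bilinear expression.\<close>
lemma spin_deriv_at_tensor:
  assumes "spinor_field M1 \<chi>1" "spinor_field M2 \<chi>2"
  shows "spin_deriv_at P (\<lambda>(i, j) (p, q). tensor (\<chi>1 i p) (\<chi>2 j q)) (i, j) (p, q) v
    = tensor (spin_deriv_at M1 \<chi>1 i p (fst v)) (\<chi>2 j q) + tensor (\<chi>1 i p) (spin_deriv_at M2 \<chi>2 j q (snd v))"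
proof -
  have s: "smooth_on (in_chart M1 i (\<chi>1 i)) (chart M1 i ` chart_dom M1 i)" "smooth_on (in_chart M2 j (\<chi>2 j)) (chart M2 j ` chart_dom M2 j)"
    using assms i j unfolding spinor_field_def by blast+
  have at: "in_chart P (i, j) F (chart P (i, j) (p, q)) = F (p, q)" for F :: "_ \<Rightarrow> 'x"
    by (rule in_chart_at_chart[OF rm1[OF P_riemannian] P_point])
  have "(in_chart P (i, j) (\<lambda>x. tensor (\<chi>1 i (fst x)) (\<chi>2 j (snd x))) has_derivative
      (\<lambda>v. tensor (\<chi>1 i p) (dir_deriv M2 j (\<chi>2 j) q (snd v)) + tensor (dir_deriv M1 i (\<chi>1 i) p (fst v)) (\<chi>2 j q))) (at (chart P (i, j) (p, q)))"
    using tensor.FDERIV[OF has_derivative_fst_factor[OF s(1)] has_derivative_snd_factor[OF s(2)]]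
    by (simp add: at) (simp add: in_chart_def comp_def)
  from dir_deriv_eqI[OF this, of v] show ?thesis
    by (simp add: spin_deriv_at_def connection_matrix_product case_prod_unfold
        mv.add_left kron_tensor tensor.add_left tensor.add_right)
qed

text \<open>If \<open>\<nabla>\<close> is given by Clifford multiplication on a spinor \<open>\<alpha>\<close> in the directions of the first factor
  and on a spinor \<open>\<beta>\<close> in those of the second factor, then contracting with the frame of a factor,
  where \<open>E\<^sub>k \<cdot> E\<^sub>k = - 1\<close>, recovers \<open>\<alpha>\<close> respectively \<open>\<beta>\<close>. The Dirac operator is the sum of the two
  contractions and its twisted version is their difference, so that \<open>\<alpha>\<close> and \<open>\<beta>\<close> are half the sum and
  half the difference of \<open>D \<Psi>\<close> and the twisted \<open>D \<Psi>\<close>. Equal dimensions of the factors are needed for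
  one constant \<open>N\<close> to serve both contractions.\<close>
lemma split_killing_equation:
  assumes nabla: "\<And>v. spin_deriv_at P \<Psi> (i, j) (p, q) v = - (1 / N) *\<^sub>R
      (clifford_matrix P (i, j) (p, q) (fst v, 0) *v \<alpha> + clifford_matrix P (i, j) (p, q) (0, snd v) *v \<beta>)"
    and N: "N = real DIM('e)" "N = real DIM('f)"
  shows "dirac P \<Psi> (i, j) (p, q) = \<alpha> + \<beta>"
    and "dirac_tilde P \<Psi> (i, j) (p, q) = \<alpha> - \<beta>"
    and "spin_deriv P X \<Psi> (i, j) (p, q) = - (1 / (2 * N)) *\<^sub>R (clifford_mult P X (dirac P \<Psi>) (i, j) (p, q)
      + clifford_mult P (product_structure X) (dirac_tilde P \<Psi>) (i, j) (p, q))"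
proof -
  let ?C = "clifford_matrix P (i, j) (p, q)" and ?S = "spin_deriv_at P \<Psi> (i, j) (p, q)"
  let ?E = "\<lambda>k. frame P k (i, j) (p, q)" and ?n = "DIM('e)" and ?m = "DIM('f)"
  interpret C: linear ?C by (rule clifford_matrix_linear[OF P_riemannian P_point])
  have N0: "N > 0" using N by simp
  have C: "?C (?E k) = gam P k" if "k < ?n + ?m" for k
    using clifford_matrix_frame[OF P_spin P_point] that by simp
  have g2: "gam P k *v (gam P k *v \<gamma>) = - \<gamma>" if "k < ?n + ?m" for k \<gamma>
  proof -
    have "spinor_module (?n + ?m) (gam P)" using rs2[OF P_spin] by simp
    from spinor_moduleD(2)[OF this that that] show ?thesis
      by (simp add: matrix_vector_mul_assoc mv.minus_left)
  qed
  have Z: "(0, 0) = (0 :: 'e \<times> 'f)" by (simp add: zero_prod_def)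
  have E1: "gam P k *v ?S (?E k) = (1 / N) *\<^sub>R \<alpha>" if "k < ?n" for k
  proof -
    have "fst (?E k) = frame M1 k i p" "snd (?E k) = 0" "(frame M1 k i p, 0) = ?E k" using that by (simp_all add: P_frame)
    then show ?thesis using that by (simp add: nabla C g2 mv.scaleR_right Z C.zero mv.zero_left mv.minus_right)
  qed
  have E2: "gam P (?n + k) *v ?S (?E (?n + k)) = (1 / N) *\<^sub>R \<beta>" if "k < ?m" for k
  proof -
    have "fst (?E (?n + k)) = 0" "snd (?E (?n + k)) = frame M2 k j q" "(0, frame M2 k j q) = ?E (?n + k)" by (simp_all add: P_frame)
    then show ?thesis using that by (simp add: nabla C g2 mv.scaleR_right Z C.zero mv.zero_left mv.minus_right)
  qed
  \<comment> \<open>The product structure reverses the frame vectors of the second factor.\<close>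
  have S_minus: "?S (- v) = - ?S v" for v
  proof -
    have "?C (- fst v, 0) = - ?C (fst v, 0)" "?C (0, - snd v) = - ?C (0, snd v)"
      using C.neg[of "(fst v, 0)"] C.neg[of "(0, snd v)"] by (simp_all add: uminus_prod_def)
    then show ?thesis by (simp add: nabla mv.minus_left flip: scaleR_minus_right)
  qed
  have d: "dirac P \<Psi> (i, j) (p, q) = (\<Sum>k<?n + ?m. gam P k *v ?S (?E k))"
    unfolding dirac_def clifford_mult_eq spin_deriv_eq by (rule sum.cong) (simp_all add: C)
  show D: "dirac P \<Psi> (i, j) (p, q) = \<alpha> + \<beta>"
    unfolding d sum_split using N N0 by (simp add: E1 E2 sum_constant_scaleR del: sum_constant)
  have pE: "product_structure (frame P k) (i, j) (p, q) = (if k < ?n then ?E k else - ?E k)" for k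
    by (simp add: product_structure_def P_frame)
  have t: "dirac_tilde P \<Psi> (i, j) (p, q) = (\<Sum>k<?n + ?m. if k < ?n then gam P k *v ?S (?E k) else - (gam P k *v ?S (?E k)))"
    unfolding dirac_tilde_def clifford_mult_eq spin_deriv_eq pE by (rule sum.cong) (simp_all add: C S_minus mv.minus_right)
  show T: "dirac_tilde P \<Psi> (i, j) (p, q) = \<alpha> - \<beta>"
    unfolding t sum_split using N N0 by (simp add: E1 E2 sum_constant_scaleR del: sum_constant)
  let ?x = "X (i, j) (p, q)"
  define c1 c2 where c: "c1 = ?C (fst ?x, 0)" "c2 = ?C (0, snd ?x)"
  have X: "?C ?x = c1 + c2" "?C (fst ?x, - snd ?x) = c1 - c2"
    using C.add[of "(fst ?x, 0)" "(0, snd ?x)"] C.diff[of "(fst ?x, 0)" "(0, snd ?x)"] by (simp_all add: c)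
  have "(c1 + c2) *v (\<alpha> + \<beta>) + (c1 - c2) *v (\<alpha> - \<beta>) = 2 *\<^sub>R (c1 *v \<alpha> + c2 *v \<beta>)"
    by (simp add: mv.add_left mv.add_right mv.diff_left mv.diff_right scaleR_2)
  then show "spin_deriv P X \<Psi> (i, j) (p, q) = - (1 / (2 * N)) *\<^sub>R (clifford_mult P X (dirac P \<Psi>) (i, j) (p, q)
      + clifford_mult P (product_structure X) (dirac_tilde P \<Psi>) (i, j) (p, q))"
    unfolding spin_deriv_eq clifford_mult_eq D T product_structure_def X nabla c[symmetric] by simp
qed

end

lemma spinor_field_tensor:
  assumes "spinor_field M1 \<chi>1" "spinor_field M2 \<chi>2"
  shows "spinor_field P (\<lambda>(i, j) (p, q). tensor (\<chi>1 i p) (\<chi>2 j q))"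
  unfolding spinor_field_def
proof (intro conjI ballI)
  fix c assume "c \<in> idx P"
  then obtain i j where c: "c = (i, j)" "i \<in> idx M1" "j \<in> idx M2" by (auto simp: P_idx_dom)
  have s: "smooth_on (in_chart M1 i (\<chi>1 i)) (chart M1 i ` chart_dom M1 i)" "smooth_on (in_chart M2 j (\<chi>2 j)) (chart M2 j ` chart_dom M2 j)"
    using assms c unfolding spinor_field_def by blast+
  have o: "open (chart M1 i ` chart_dom M1 i)" "open (chart M2 j ` chart_dom M2 j)" "open (chart_dom M1 i)" "open (chart_dom M2 j)"
    by (intro chart_homeo smooth_factors c)+
  show "smooth_on (in_chart P c ((\<lambda>(i, j) (p, q). tensor (\<chi>1 i p) (\<chi>2 j q)) c)) (chart P c ` chart_dom P c)"
    unfolding c P_idx_dom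
    by (rule P_smooth[OF c(2,3) o(3,4) order_refl order_refl
          smooth_bilinear[OF open_Times[OF o(1,2)] tensor.bounded_bilinear_axioms smooth_fst[OF o(1,2) s(1)] smooth_snd[OF o(1,2) s(2)]]])
      (simp add: in_chart_at_chart smooth_factors c)
  fix c' x assume "c' \<in> idx P" "x \<in> chart_dom P c \<inter> chart_dom P c'"
  then obtain i' j' p q where c': "c' = (i', j')" "x = (p, q)" "i' \<in> idx M1" "j' \<in> idx M2"
    "p \<in> chart_dom M1 i \<inter> chart_dom M1 i'" "q \<in> chart_dom M2 j \<inter> chart_dom M2 j'" by (auto simp: P_idx_dom c)
  have "\<chi>1 i p = lift M1 i i' p *v \<chi>1 i' p" "\<chi>2 j q = lift M2 j j' q *v \<chi>2 j' q"
    using assms c c' unfolding spinor_field_def by blast+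
  then show "(\<lambda>(i, j) (p, q). tensor (\<chi>1 i p) (\<chi>2 j q)) c x = lift P c c' x *v (\<lambda>(i, j) (p, q). tensor (\<chi>1 i p) (\<chi>2 j q)) c' x"
    unfolding c c' prod.case P_lift kron_tensor by (simp only:)
qed

end

section \<open>The eigenspinor\<close>

text \<open>On the span of \<open>\<psi>\<^sub>1 \<otimes> \<psi>\<^sub>2\<close> and \<open>\<omega>\<psi>\<^sub>1 \<otimes> \<psi>\<^sub>2\<close> the Dirac operator acts by the symmetric matrix with rows
  \<open>(\<mu>\<^sub>1, \<mu>\<^sub>2)\<close> and \<open>(\<mu>\<^sub>2, - \<mu>\<^sub>1)\<close>, whose eigenvalues are the two square roots of \<open>\<mu>\<^sub>1\<^sup>2 + \<mu>\<^sub>2\<^sup>2\<close>. The root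
  with the sign of \<open>\<mu>\<^sub>1\<close> has an eigenvector with \<open>a\<^sup>2 \<noteq> b\<^sup>2\<close>. This makes \<open>a + b \<omega>\<close> invertible, so that the
  eigenspinor vanishes only where \<open>\<psi>\<^sub>1\<close> or \<open>\<psi>\<^sub>2\<close> does, although \<open>\<psi>\<^sub>1\<close> and \<open>\<omega>\<psi>\<^sub>1\<close> may be linearly dependent at a point.\<close>
lemma tensor_killing_eigenvector:
  fixes \<mu>1 \<mu>2 :: real
  assumes "\<mu>1 \<noteq> 0"
  obtains \<mu> a b :: real where "\<mu> \<noteq> 0" "\<mu>1 * a + \<mu>2 * b = \<mu> * a" "\<mu>2 * a - \<mu>1 * b = \<mu> * b" "a\<^sup>2 - b\<^sup>2 \<noteq> 0"
proof
  define \<mu> where "\<mu> = sgn \<mu>1 * sqrt (\<mu>1\<^sup>2 + \<mu>2\<^sup>2)"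
  have pos: "\<mu>1\<^sup>2 + \<mu>2\<^sup>2 > 0" using assms by (simp add: add_pos_nonneg)
  show "\<mu> \<noteq> 0" using pos assms by (simp add: \<mu>_def sgn_zero_iff del: real_sqrt_gt_0_iff)
  have sq: "\<mu> * \<mu> = \<mu>1 * \<mu>1 + \<mu>2 * \<mu>2"
  proof -
    have "\<mu> * \<mu> = (sgn \<mu>1 * sgn \<mu>1) * (sqrt (\<mu>1\<^sup>2 + \<mu>2\<^sup>2) * sqrt (\<mu>1\<^sup>2 + \<mu>2\<^sup>2))"
      by (simp only: \<mu>_def mult_ac)
    also have "sgn \<mu>1 * sgn \<mu>1 = 1" using assms by (simp add: sgn_if)
    also have "sqrt (\<mu>1\<^sup>2 + \<mu>2\<^sup>2) * sqrt (\<mu>1\<^sup>2 + \<mu>2\<^sup>2) = \<mu>1\<^sup>2 + \<mu>2\<^sup>2"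
      using pos by simp
    finally show ?thesis by (simp add: power2_eq_square)
  qed
  show "\<mu>1 * (\<mu>1 + \<mu>) + \<mu>2 * \<mu>2 = \<mu> * (\<mu>1 + \<mu>)" using sq by (simp add: algebra_simps)
  show "\<mu>2 * (\<mu>1 + \<mu>) - \<mu>1 * \<mu>2 = \<mu> * \<mu>2" by (simp add: algebra_simps)
  have "\<mu>1 * \<mu> = \<bar>\<mu>1\<bar> * sqrt (\<mu>1\<^sup>2 + \<mu>2\<^sup>2)" by (simp add: \<mu>_def abs_sgn)
  then have "\<mu>1 * \<mu> \<ge> 0" by simp
  moreover have "\<mu>1 * \<mu>1 > 0" using assms by (auto simp: zero_less_mult_iff)
  moreover have "(\<mu>1 + \<mu>)\<^sup>2 - \<mu>2\<^sup>2 = 2 * (\<mu>1 * \<mu>1) + 2 * (\<mu>1 * \<mu>)"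
    using sq by (simp add: power2_eq_square algebra_simps)
  ultimately show "(\<mu>1 + \<mu>)\<^sup>2 - \<mu>2\<^sup>2 \<noteq> 0" by linarith
qed

theorem theorem4p1:
  fixes M1 :: "('a::{t2_space, second_countable_topology}, 'i, 'e::euclidean_space, 's::finite) spin_atlas"
    and M2 :: "('b::{t2_space, second_countable_topology}, 'j, 'f::euclidean_space, 't::finite) spin_atlas"
    and \<psi>1 :: "'i \<Rightarrow> 'a \<Rightarrow> complex^'s"
    and \<psi>2 :: "'j \<Rightarrow> 'b \<Rightarrow> complex^'t"
    and \<mu>1 \<mu>2 :: real
    and m :: nat
  assumes "m \<ge> 1"
    and "riemannian_spin_manifold M1" and "DIM('e) = 2 * m"
    and "killing_spinor M1 \<mu>1 \<psi>1"
    and "same_field M1 (dirac M1 \<psi>1) (\<lambda>i p. \<mu>1 *\<^sub>R \<psi>1 i p)" and "\<mu>1 \<noteq> 0"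
    and "riemannian_spin_manifold M2" and "DIM('f) = 2 * m"
    and "killing_spinor M2 \<mu>2 \<psi>2"
    and "same_field M2 (dirac M2 \<psi>2) (\<lambda>j q. \<mu>2 *\<^sub>R \<psi>2 j q)"
  shows "\<exists>\<psi>' \<mu>. \<mu> \<noteq> 0 \<and> dirac_eigenspinor (spin_product M1 M2) \<mu> \<psi>' \<and>
    (\<forall>X. vector_field (spin_product M1 M2) X \<longrightarrow>
      same_field (spin_product M1 M2)
        (spin_deriv (spin_product M1 M2) X \<psi>')
        (\<lambda>c x. - (\<mu> / real (4 * m)) *\<^sub>R clifford_mult (spin_product M1 M2) X \<psi>' c x
             - (1 / real (4 * m)) *\<^sub>R
                 clifford_mult (spin_product M1 M2) (product_structure X)
                   (dirac_tilde (spin_product M1 M2) \<psi>') c x))"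
proof -
  let ?P = "spin_product M1 M2" and ?N = "real (2 * m)"
  have ev: "even DIM('e)" "even DIM('f)" using assms by simp_all
  note M1 = \<open>riemannian_spin_manifold M1\<close> and M2 = \<open>riemannian_spin_manifold M2\<close>
  note sp = rs2[OF M1] and sm = rm1[OF rs1[OF M1]] rm1[OF rs1[OF M2]]
  have \<psi>: "spinor_field M1 \<psi>1" "spinor_field M2 \<psi>2"
    using assms unfolding killing_spinor_def nontrivial_spinor_field_def by blast+
  let ?W = "volume_scalar DIM('e) (gam M1)"
  obtain \<mu> a b where \<mu>: "\<mu> \<noteq> 0" "\<mu>1 * a + \<mu>2 * b = \<mu> * a" "\<mu>2 * a - \<mu>1 * b = \<mu> * b" "a\<^sup>2 - b\<^sup>2 \<noteq> 0"
    using tensor_killing_eigenvector[OF \<open>\<mu>1 \<noteq> 0\<close>] by blast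
  define \<xi> where "\<xi> i p = ?W a b *v \<psi>1 i p" for i p
  define \<Psi> where "\<Psi> = (\<lambda>(i, j) (p, q). tensor (\<xi> i p) (\<psi>2 j q))"
  have \<xi>: "spinor_field M1 \<xi>"
    using spinor_field_volume_scalar[OF M1 ev(1) \<psi>(1)] by (simp add: \<xi>_def[abs_def])
  have \<Psi>: "spinor_field ?P \<Psi>"
    unfolding \<Psi>_def by (rule spinor_field_tensor[OF M1 M2 ev \<xi> \<psi>(2)])
  have idx: "idx ?P = idx M1 \<times> idx M2" "chart_dom ?P (i, j) = chart_dom M1 i \<times> chart_dom M2 j" for i j
    by (simp_all add: spin_product_def)
  \<comment> \<open>\<open>(a - b \<omega>) (a + b \<omega>) = a\<^sup>2 - b\<^sup>2\<close> as \<open>\<omega>\<close> squares to \<open>1\<close>.\<close>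
  have inv: "?W a (- b) *v (?W a b *v u) = (a\<^sup>2 - b\<^sup>2) *\<^sub>R u" for u
    by (simp add: matrix_vector_mul_assoc volume_scalar_mult[OF sp ev(1)] mult.commute power2_eq_square)
      (simp add: volume_scalar_def mv.scaleR_left)
  have nontrivial: "\<exists>c\<in>idx ?P. \<exists>x\<in>chart_dom ?P c. \<Psi> c x \<noteq> 0"
  proof -
    obtain i p j q where ip: "i \<in> idx M1" "p \<in> chart_dom M1 i" "\<psi>1 i p \<noteq> 0" "j \<in> idx M2" "q \<in> chart_dom M2 j" "\<psi>2 j q \<noteq> 0"
      using assms unfolding killing_spinor_def nontrivial_spinor_field_def by blast
    have "\<xi> i p \<noteq> 0" using inv[of "\<psi>1 i p"] \<mu>(4) ip(3) by (auto simp: \<xi>_def mv.zero_right)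
    then have "\<Psi> (i, j) (p, q) \<noteq> 0" using ip by (simp add: \<Psi>_def tensor_eq_0)
    then show ?thesis using ip by (auto simp: idx)
  qed
  have main: "dirac ?P \<Psi> c x = \<mu> *\<^sub>R \<Psi> c x \<and> (\<forall>X. spin_deriv ?P X \<Psi> c x =
      - (1 / (2 * ?N)) *\<^sub>R (clifford_mult ?P X (dirac ?P \<Psi>) c x
         + clifford_mult ?P (product_structure X) (dirac_tilde ?P \<Psi>) c x))"
    if cx: "c \<in> idx ?P" "x \<in> chart_dom ?P c" for c x
  proof -
    obtain i j p q where c: "c = (i, j)" "x = (p, q)" and i: "i \<in> idx M1" and j: "j \<in> idx M2"
      and p: "p \<in> chart_dom M1 i" and q: "q \<in> chart_dom M2 j"
      using cx by (cases c; cases x) (auto simp: idx)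
    define \<alpha> where "\<alpha> = tensor (?W (\<mu>1 * a) (- (\<mu>1 * b)) *v \<psi>1 i p) (\<psi>2 j q)"
    define \<beta> where "\<beta> = tensor (?W (\<mu>2 * b) (\<mu>2 * a) *v \<psi>1 i p) (\<psi>2 j q)"
    \<comment> \<open>The sign change of \<open>b\<close> comes from moving \<open>a + b \<omega>\<close> past the vector.\<close>
    have d1: "spin_deriv_at M1 \<xi> i p v = - (1 / ?N) *\<^sub>R (clifford_matrix M1 i p v *v (?W (\<mu>1 * a) (- (\<mu>1 * b)) *v \<psi>1 i p))" for v
    proof -
      have "spin_deriv_at M1 \<xi> i p v = ?W a b *v spin_deriv_at M1 \<psi>1 i p v"
        using spin_deriv_at_volume_scalar[OF M1 ev(1) \<psi>(1) i p] by (simp add: \<xi>_def[abs_def])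
      also have "\<dots> = - (\<mu>1 / ?N) *\<^sub>R (?W a b *v (clifford_matrix M1 i p v *v \<psi>1 i p))"
        using killing_spinor_at[OF sm(1) \<open>killing_spinor M1 \<mu>1 \<psi>1\<close> i p, of v] assms by (simp add: mv.scaleR_right mv.minus_right)
      also have "?W a b *v (clifford_matrix M1 i p v *v \<psi>1 i p) = clifford_matrix M1 i p v *v (?W a (- b) *v \<psi>1 i p)"
        by (simp add: matrix_vector_mul_assoc volume_scalar_clifford_matrix[OF sp ev(1)])
      also have "- (\<mu>1 / ?N) *\<^sub>R (clifford_matrix M1 i p v *v (?W a (- b) *v \<psi>1 i p))
        = - (1 / ?N) *\<^sub>R (clifford_matrix M1 i p v *v ((\<mu>1 *\<^sub>R ?W a (- b)) *v \<psi>1 i p))"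
        by (simp add: mv.scaleR_left mv.scaleR_right)
      finally show ?thesis by (simp add: volume_scalar_arith(2))
    qed
    have d2: "spin_deriv_at M2 \<psi>2 j q v = - (\<mu>2 / ?N) *\<^sub>R (clifford_matrix M2 j q v *v \<psi>2 j q)" for v
      using killing_spinor_at[OF sm(2) \<open>killing_spinor M2 \<mu>2 \<psi>2\<close> j q, of v] assms by simp
    \<comment> \<open>Vectors of the second factor act through an additional \<open>\<omega>\<close>, which \<open>\<beta>\<close> has to compensate:
      multiplication by \<open>\<omega>\<close> swaps the two coefficients.\<close>
    have w: "volume_element DIM('e) (gam M1) *v (?W (\<mu>2 * b) (\<mu>2 * a) *v u) = \<mu>2 *\<^sub>R (?W a b *v u)" for u
      unfolding volume_scalar_arith(3) matrix_vector_mul_assoc volume_scalar_mult[OF sp ev(1)]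
      by (simp add: volume_scalar_arith(2)[symmetric] mv.scaleR_left)
    have C: "clifford_matrix ?P (i, j) (p, q) (v1, 0) = kron (clifford_matrix M1 i p v1) (mat 1)"
      "clifford_matrix ?P (i, j) (p, q) (0, v2) = kron (volume_element DIM('e) (gam M1)) (clifford_matrix M2 j q v2)" for v1 v2
      using linear_0[OF clifford_matrix_linear[OF rs1[OF M1] i p]] linear_0[OF clifford_matrix_linear[OF rs1[OF M2] j q]]
      by (simp_all add: clifford_matrix_product[OF M1 M2 ev i j p q] kron_zero)
    have "spin_deriv_at ?P \<Psi> (i, j) (p, q) v = - (1 / ?N) *\<^sub>R
      (clifford_matrix ?P (i, j) (p, q) (fst v, 0) *v \<alpha> + clifford_matrix ?P (i, j) (p, q) (0, snd v) *v \<beta>)" for v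
      unfolding \<Psi>_def spin_deriv_at_tensor[OF M1 M2 ev i j p q \<xi> \<psi>(2)] d1 d2 \<alpha>_def \<beta>_def C kron_tensor w
      by (simp add: \<xi>_def tensor.scaleR_left tensor.scaleR_right tensor.minus_left tensor.minus_right scaleR_add_right)
    note split = split_killing_equation[OF M1 M2 ev i j p q this]
    have "\<alpha> + \<beta> = tensor ((?W (\<mu>1 * a) (- (\<mu>1 * b)) + ?W (\<mu>2 * b) (\<mu>2 * a)) *v \<psi>1 i p) (\<psi>2 j q)"
      by (simp add: \<alpha>_def \<beta>_def tensor.add_left mv.add_left)
    also have "?W (\<mu>1 * a) (- (\<mu>1 * b)) + ?W (\<mu>2 * b) (\<mu>2 * a) = \<mu> *\<^sub>R ?W a b"
      unfolding volume_scalar_arith(1,2) using \<mu>(2,3) by simp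
    finally have ab: "\<alpha> + \<beta> = \<mu> *\<^sub>R \<Psi> c x" by (simp add: \<Psi>_def c \<xi>_def mv.scaleR_left tensor.scaleR_left)
    show ?thesis using split(1,3) ab assms by (simp add: c)
  qed
  show ?thesis
  proof (intro exI conjI allI impI)
    show "\<mu> \<noteq> 0" by (rule \<mu>(1))
    show "dirac_eigenspinor ?P \<mu> \<Psi>"
      unfolding dirac_eigenspinor_def nontrivial_spinor_field_def same_field_def using \<Psi> nontrivial main by blast
    show "same_field ?P (spin_deriv ?P X \<Psi>)
        (\<lambda>c x. - (\<mu> / real (4 * m)) *\<^sub>R clifford_mult ?P X \<Psi> c x
             - (1 / real (4 * m)) *\<^sub>R clifford_mult ?P (product_structure X) (dirac_tilde ?P \<Psi>) c x)" for X
      unfolding same_field_def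
    proof (intro ballI)
      fix c x assume cx: "c \<in> idx ?P" "x \<in> chart_dom ?P c"
      have "clifford_mult ?P X (dirac ?P \<Psi>) c x = \<mu> *\<^sub>R clifford_mult ?P X \<Psi> c x"
        using main[OF cx] by (simp add: clifford_mult_eq mv.scaleR_right)
      then show "spin_deriv ?P X \<Psi> c x = - (\<mu> / real (4 * m)) *\<^sub>R clifford_mult ?P X \<Psi> c x
             - (1 / real (4 * m)) *\<^sub>R clifford_mult ?P (product_structure X) (dirac_tilde ?P \<Psi>) c x"
        using main[OF cx] by (simp add: scaleR_add_right)
    qed
  qed
qed

end
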